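(* Let $X$ be a mediangle graph. The following assertions hold. (i) Hyperplanes separate $X$. More precisely, given a hyperplane $J$ and a clique $C\subset J$ (i.e. a clique whose edges belong to $J$), any two distinct vertices in $C$ are separated by $J$ and every sector delimited by $J$ contains a vertex of $C$. (ii) Sectors delimited by hyperplanes are always convex. (iii) A path in $X$ is a geodesic if and only if it crosses each hyperplane at most once (i.e. at most one of its successive edges belongs to any given hyperplane). As a consequence, the distance between any two vertices coincides with the number of hyperplanes separating them.
   Context: All graphs are simplicial (no loops, no multiple edges). Subgraphs are identified with sets of vertices endowed with the induced adjacency relation; connected graphs are non-empty. $d$ denotes the graph distance and $I(x,y)=\{z \mid d(x,y)=d(x,z)+d(z,y)\}$. A subgraph $Y$ is convex if $I(x,y)\subset Y$ for all $x,y\in Y$. A convex cycle is a convex subgraph isomorphic to a cycle. A clique is a maximal complete subgraph. A path is a sequence of vertices in which any two successive vertices are adjacent. A connected graph $X$ is mediangle if: (Triangle Condition) for all vertices $o,x,y$ with $d(o,x)=d(o,y)$ and $d(x,y)=1$, there is a common neighbour $z$ of $x,y$ with $z\in I(o,x)\cap I(o,y)$; (Intersection of Triangles) $X$ contains no induced copy of $K_4^-$ (the complete graph $K_4$ minus an edge); (Cycle Condition) for all vertices $o,x,y,z$ with $x\neq y$, $d(o,x)=d(o,y)=d(o,z)-1$ and $d(x,z)=d(y,z)=1$, there is a convex cycle of even length containing the edges $[z,x],[z,y]$ such that the vertex opposite to $z$ in it belongs to $I(o,x)\cap I(o,y)$; (Intersection of Even Cycles) the intersection of any two distinct convex cycles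 of even lengths contains at most one edge. A hyperplane of $X$ is an equivalence class of edges with respect to the transitive closure of the relation that identifies two edges whenever they belong to a common $3$-cycle or are opposite in a convex cycle of even length. The sectors delimited by a hyperplane $J$ are the connected components of the graph obtained from $X$ by removing (only) the edges in $J$. Two vertices are separated by $J$ if they lie in distinct sectors delimited by $J$. *)

theory Defs
  imports Main
begin

text \<open>
  A graph is given by its vertex set \<open>V\<close>, possibly infinite, and its edge set \<open>E\<close>, whose
  elements are two-element sets of vertices: \<open>x\<close> and \<open>y\<close> are adjacent iff \<open>{x, y} \<in> E\<close>.
\<close>

definition simplicial_graph :: "'a set \<Rightarrow> 'a set set \<Rightarrow> bool" where
  "simplicial_graph V E \<longleftrightarrow> (\<forall>e\<in>E. \<exists>x\<in>V. \<exists>y\<in>V. x \<noteq> y \<and> e = {x, y})"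

definition induced_edges :: "'a set set \<Rightarrow> 'a set \<Rightarrow> 'a set set" where
  "induced_edges E Y = {e \<in> E. e \<subseteq> Y}"

definition graph_path :: "'a set \<Rightarrow> 'a set set \<Rightarrow> 'a list \<Rightarrow> bool" where
  "graph_path V E p \<longleftrightarrow> p \<noteq> [] \<and> set p \<subseteq> V \<and> successively (\<lambda>x y. {x, y} \<in> E) p"

definition joins :: "'a set \<Rightarrow> 'a set set \<Rightarrow> 'a list \<Rightarrow> 'a \<Rightarrow> 'a \<Rightarrow> bool" where
  "joins V E p x y \<longleftrightarrow> graph_path V E p \<and> hd p = x \<and> last p = y"

definition connected_graph :: "'a set \<Rightarrow> 'a set set \<Rightarrow> bool" where
  "connected_graph V E \<longleftrightarrow> V \<noteq> {} \<and> (\<forall>x\<in>V. \<forall>y\<in>V. \<exists>p. joins V E p x y)"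

text \<open>
  A path has one more vertex than it has edges. The value of \<open>gdist\<close> is meaningful only for
  vertices joined by a path; it is used only in connected graphs.
\<close>

definition gdist :: "'a set \<Rightarrow> 'a set set \<Rightarrow> 'a \<Rightarrow> 'a \<Rightarrow> nat" where
  "gdist V E x y = (LEAST n. \<exists>p. joins V E p x y \<and> length p = Suc n)"

definition geodesic :: "'a set \<Rightarrow> 'a set set \<Rightarrow> 'a list \<Rightarrow> bool" where
  "geodesic V E p \<longleftrightarrow> graph_path V E p \<and> length p = Suc (gdist V E (hd p) (last p))"

definition interval :: "'a set \<Rightarrow> 'a set set \<Rightarrow> 'a \<Rightarrow> 'a \<Rightarrow> 'a set" where
  "interval V E x y = {z \<in> V. gdist V E x y = gdist V E x z + gdist V E z y}"

definition convex_subgraph :: "'a set \<Rightarrow> 'a set set \<Rightarrow> 'a set \<Rightarrow> bool" where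
  "convex_subgraph V E Y \<longleftrightarrow> Y \<subseteq> V \<and> (\<forall>x\<in>Y. \<forall>y\<in>Y. interval V E x y \<subseteq> Y)"

definition complete_subgraph :: "'a set \<Rightarrow> 'a set set \<Rightarrow> 'a set \<Rightarrow> bool" where
  "complete_subgraph V E C \<longleftrightarrow> C \<subseteq> V \<and> (\<forall>x\<in>C. \<forall>y\<in>C. x \<noteq> y \<longrightarrow> {x, y} \<in> E)"

definition maximal_clique :: "'a set \<Rightarrow> 'a set set \<Rightarrow> 'a set \<Rightarrow> bool" where
  "maximal_clique V E C \<longleftrightarrow> complete_subgraph V E C \<and>
     (\<forall>D. complete_subgraph V E D \<and> C \<subseteq> D \<longrightarrow> D = C)"

definition graph_iso ::
    "('a \<Rightarrow> 'b) \<Rightarrow> 'a set \<Rightarrow> 'a set set \<Rightarrow> 'b set \<Rightarrow> 'b set set \<Rightarrow> bool" where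
  "graph_iso f V E V' E' \<longleftrightarrow> bij_betw f V V' \<and>
     (\<forall>x\<in>V. \<forall>y\<in>V. {x, y} \<in> E \<longleftrightarrow> {f x, f y} \<in> E')"

definition cycle_edges :: "nat \<Rightarrow> nat set set" where
  "cycle_edges n = {{i, Suc i mod n} | i. i < n}"

text \<open>The map \<open>c\<close> enumerates, in cyclic order, an induced subgraph \<open>Y\<close> that is an \<open>n\<close>-cycle.\<close>

definition cycle_enum :: "'a set set \<Rightarrow> 'a set \<Rightarrow> nat \<Rightarrow> (nat \<Rightarrow> 'a) \<Rightarrow> bool" where
  "cycle_enum E Y n c \<longleftrightarrow>
     3 \<le> n \<and> graph_iso c {..<n} (cycle_edges n) Y (induced_edges E Y)"

definition convex_even_cycle :: "'a set \<Rightarrow> 'a set set \<Rightarrow> 'a set \<Rightarrow> bool" where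
  "convex_even_cycle V E Y \<longleftrightarrow>
     convex_subgraph V E Y \<and> (\<exists>n c. even n \<and> cycle_enum E Y n c)"

definition opposite_vertices :: "'a set set \<Rightarrow> 'a set \<Rightarrow> 'a \<Rightarrow> 'a \<Rightarrow> bool" where
  "opposite_vertices E Y u v \<longleftrightarrow>
     (\<exists>m c i. cycle_enum E Y (2 * m) c \<and> i < 2 * m \<and>
        u = c i \<and> v = c ((i + m) mod (2 * m)))"

definition opposite_edges :: "'a set set \<Rightarrow> 'a set \<Rightarrow> 'a set \<Rightarrow> 'a set \<Rightarrow> bool" where
  "opposite_edges E Y e e' \<longleftrightarrow>
     (\<exists>m c i. cycle_enum E Y (2 * m) c \<and> i < 2 * m \<and>
        e = {c i, c (Suc i mod (2 * m))} \<and>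
        e' = {c ((i + m) mod (2 * m)), c (Suc (i + m) mod (2 * m))})"

definition K4_minus_edges :: "nat set set" where
  "K4_minus_edges = {{i, j} | i j. i < 4 \<and> j < 4 \<and> i \<noteq> j} - {{0, 1}}"

definition triangle_condition :: "'a set \<Rightarrow> 'a set set \<Rightarrow> bool" where
  "triangle_condition V E \<longleftrightarrow>
     (\<forall>o'\<in>V. \<forall>x\<in>V. \<forall>y\<in>V.
        gdist V E o' x = gdist V E o' y \<and> gdist V E x y = 1 \<longrightarrow>
        (\<exists>z\<in>V. {x, z} \<in> E \<and> {y, z} \<in> E \<and> z \<in> interval V E o' x \<inter> interval V E o' y))"

definition intersection_of_triangles :: "'a set \<Rightarrow> 'a set set \<Rightarrow> bool" where
  "intersection_of_triangles V E \<longleftrightarrow>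
     \<not> (\<exists>Y f. Y \<subseteq> V \<and> graph_iso f {..<4} K4_minus_edges Y (induced_edges E Y))"

definition cycle_condition :: "'a set \<Rightarrow> 'a set set \<Rightarrow> bool" where
  "cycle_condition V E \<longleftrightarrow>
     (\<forall>o'\<in>V. \<forall>x\<in>V. \<forall>y\<in>V. \<forall>z\<in>V.
        x \<noteq> y \<and> gdist V E o' x = gdist V E o' y \<and> gdist V E o' z = gdist V E o' y + 1 \<and>
        gdist V E x z = 1 \<and> gdist V E y z = 1 \<longrightarrow>
        (\<exists>Y. convex_even_cycle V E Y \<and>
           {z, x} \<in> induced_edges E Y \<and> {z, y} \<in> induced_edges E Y \<and>
           (\<exists>w. opposite_vertices E Y z w \<and> w \<in> interval V E o' x \<inter> interval V E o' y)))"

definition intersection_of_even_cycles :: "'a set \<Rightarrow> 'a set set \<Rightarrow> bool" where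
  "intersection_of_even_cycles V E \<longleftrightarrow>
     (\<forall>Y Z. convex_even_cycle V E Y \<and> convex_even_cycle V E Z \<and> Y \<noteq> Z \<longrightarrow>
        (\<forall>e\<in>induced_edges E (Y \<inter> Z). \<forall>e'\<in>induced_edges E (Y \<inter> Z). e = e'))"

definition mediangle_graph :: "'a set \<Rightarrow> 'a set set \<Rightarrow> bool" where
  "mediangle_graph V E \<longleftrightarrow> simplicial_graph V E \<and> connected_graph V E \<and>
     triangle_condition V E \<and> intersection_of_triangles V E \<and>
     cycle_condition V E \<and> intersection_of_even_cycles V E"

definition edge_rel :: "'a set \<Rightarrow> 'a set set \<Rightarrow> 'a set rel" where
  "edge_rel V E = {(e, e'). e \<in> E \<and> e' \<in> E \<and>
     ((\<exists>Y c. Y \<subseteq> V \<and> cycle_enum E Y 3 c \<and> e \<subseteq> Y \<and> e' \<subseteq> Y) \<or>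
      (\<exists>Y. convex_even_cycle V E Y \<and> opposite_edges E Y e e'))}"

text \<open>
  The reflexive closure matters: an edge lying in no 3-cycle and in no convex even cycle
  forms a hyperplane by itself.
\<close>

definition hyperplanes :: "'a set \<Rightarrow> 'a set set \<Rightarrow> 'a set set set" where
  "hyperplanes V E = E // (edge_rel V E)\<^sup>*"

definition components :: "'a set \<Rightarrow> 'a set set \<Rightarrow> 'a set set" where
  "components V E = V // {(x, y). \<exists>p. joins V E p x y}"

definition sectors :: "'a set \<Rightarrow> 'a set set \<Rightarrow> 'a set set \<Rightarrow> 'a set set" where
  "sectors V E J = components V (E - J)"

definition separated_by :: "'a set \<Rightarrow> 'a set set \<Rightarrow> 'a set set \<Rightarrow> 'a \<Rightarrow> 'a \<Rightarrow> bool" where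
  "separated_by V E J x y \<longleftrightarrow>
     (\<exists>S\<in>sectors V E J. \<exists>T\<in>sectors V E J. S \<noteq> T \<and> x \<in> S \<and> y \<in> T)"

text \<open>Crossings are counted by position, so traversing the same edge twice counts twice.\<close>

definition crossings :: "'a list \<Rightarrow> 'a set set \<Rightarrow> nat" where
  "crossings p J = card {i. Suc i < length p \<and> {p ! i, p ! Suc i} \<in> J}"

end

theory Submission
  imports Defs
begin

text \<open>
  For a clique \<open>C\<close> (maximal, in the paper's sense) the absence of \<open>K\<^sub>4\<^sup>-\<close> and the triangle
  condition give every vertex a unique nearest point of \<open>C\<close>, its gate. An edge crosses the
  hyperplane of \<open>C\<close> iff its ends have different gates on \<open>C\<close>. The point is that on a convex
  even cycle the edge opposite to one along which the distance to a vertex \<open>x\<close> grows is again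
  one along which it grows, in the parallel direction. If the distance to \<open>x\<close> has a peak on the
  cycle, the cycle condition and the intersection property determine it on the whole cycle.
  Otherwise two adjacent vertices are equidistant from \<open>x\<close>, so the cycle has an edge in a
  triangle, which forces it to be a square. Conversely, an edge with different gates is moved
  towards \<open>C\<close> through convex even cycles.

  Hence the sectors of a hyperplane are the fibres of the gate map. After a geodesic has
  traversed an edge \<open>{u, v}\<close> from \<open>u\<close> to \<open>v\<close>, all its vertices have gate \<open>v\<close>, so it never
  crosses that hyperplane again; the distance is therefore the number of separating hyperplanes.
  Convexity of a sector follows by counting: a hyperplane separating \<open>z\<close> from both \<open>x\<close> and \<open>y\<close>,
  but not \<open>x\<close> from \<open>y\<close>, makes the triangle inequality through \<open>z\<close> strict.
\<close>

subsection \<open>Cycles and parallel edges\<close>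

lemma Suc_mod_lt:
  fixes i n :: nat
  assumes "i < n"
  shows "Suc i mod n = (if Suc i = n then 0 else Suc i)"
  using assms by auto

lemma cycle_edges_iff:
  assumes "i < n" "j < n"
  shows "{i, j} \<in> cycle_edges n \<longleftrightarrow> j = Suc i mod n \<or> i = Suc j mod n"
  using assms unfolding cycle_edges_def by (auto simp: doubleton_eq_iff)

lemma cycle_enum_iff:
  "cycle_enum E Y n c \<longleftrightarrow> 3 \<le> n \<and> bij_betw c {..<n} Y \<and>
     (\<forall>i<n. \<forall>j<n. {c i, c j} \<in> E \<longleftrightarrow> j = Suc i mod n \<or> i = Suc j mod n)"
proof -
  have "{c i, c j} \<in> induced_edges E Y \<longleftrightarrow> {c i, c j} \<in> E"
    if "bij_betw c {..<n} Y" "i < n" "j < n" for i j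
    using that by (auto simp: induced_edges_def bij_betw_def)
  then show ?thesis
    unfolding cycle_enum_def graph_iso_def by (auto simp: cycle_edges_iff)
qed

lemma cycle_enum_reindex:
  assumes c: "cycle_enum E Y n c" and "bij_betw s {..<n} {..<n}"
    and "\<And>i j. i < n \<Longrightarrow> j < n \<Longrightarrow>
       (s j = Suc (s i) mod n \<or> s i = Suc (s j) mod n) \<longleftrightarrow> (j = Suc i mod n \<or> i = Suc j mod n)"
  shows "cycle_enum E Y n (\<lambda>i. c (s i))"
proof -
  have "s i < n" if "i < n" for i
    using assms(2) that by (auto simp: bij_betw_def)
  moreover have "bij_betw (\<lambda>i. c (s i)) {..<n} Y"
    using bij_betw_trans[OF assms(2)] c by (force simp: cycle_enum_iff comp_def)
  ultimately show ?thesis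
    using c assms(3) by (simp add: cycle_enum_iff)
qed

lemma cycle_enum_rotate:
  assumes "cycle_enum E Y n c" "k < n"
  shows "cycle_enum E Y n (\<lambda>i. c ((i + k) mod n))"
proof (rule cycle_enum_reindex[OF assms(1)])
  show "bij_betw (\<lambda>i. (i + k) mod n) {..<n} {..<n}"
    using assms(2)
    by (intro bij_betw_byWitness[where f' = "\<lambda>i. (i + (n - k)) mod n"])
       (auto simp: mod_if)
  show "((j + k) mod n = Suc ((i + k) mod n) mod n \<or> (i + k) mod n = Suc ((j + k) mod n) mod n)
     \<longleftrightarrow> (j = Suc i mod n \<or> i = Suc j mod n)" if "i < n" "j < n" for i j
    using that assms(2) by (auto simp: mod_if)
qed

lemma cycle_enum_reflect:
  assumes "cycle_enum E Y n c"
  shows "cycle_enum E Y n (\<lambda>i. c ((n - i) mod n))"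
proof (rule cycle_enum_reindex[OF assms(1)])
  have n: "3 \<le> n" using assms by (simp add: cycle_enum_iff)
  show "bij_betw (\<lambda>i. (n - i) mod n) {..<n} {..<n}"
    using n
    by (intro bij_betw_byWitness[where f' = "\<lambda>i. (n - i) mod n"])
       (auto simp: mod_if)
  show "((n - j) mod n = Suc ((n - i) mod n) mod n \<or> (n - i) mod n = Suc ((n - j) mod n) mod n)
     \<longleftrightarrow> (j = Suc i mod n \<or> i = Suc j mod n)" if "i < n" "j < n" for i j
    using that n by (auto simp: mod_if)
qed

lemma cycle_enum_card: "cycle_enum E Y n c \<Longrightarrow> card Y = n"
  by (metis bij_betw_same_card card_lessThan cycle_enum_iff)

lemma cycle_enum_mem: "cycle_enum E Y n c \<Longrightarrow> i < n \<Longrightarrow> c i \<in> Y"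
  by (auto simp: cycle_enum_iff bij_betw_def)

lemma cycle_enum_eq_iff:
  "cycle_enum E Y n c \<Longrightarrow> i < n \<Longrightarrow> j < n \<Longrightarrow> c i = c j \<longleftrightarrow> i = j"
  by (auto simp: cycle_enum_iff bij_betw_def inj_on_def)

lemma cycle_enum_obtain:
  assumes "cycle_enum E Y n c" "y \<in> Y"
  obtains i where "i < n" "y = c i"
  using assms by (auto simp: cycle_enum_iff bij_betw_def)

lemma cycle_enum_from_vertex:
  assumes "cycle_enum E Y n c" "y \<in> Y"
  obtains c' where "cycle_enum E Y n c'" "c' 0 = y"
proof -
  obtain i where "i < n" "y = c i" using cycle_enum_obtain[OF assms] .
  then show ?thesis
    using that[of "\<lambda>j. c ((j + i) mod n)"] cycle_enum_rotate[OF assms(1)] by simp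
qed

lemma cycle_enum_neighbours_0:
  assumes "cycle_enum E Y n c" "y \<in> Y" "{c 0, y} \<in> E"
  shows "y = c 1 \<or> y = c (n - 1)"
proof -
  obtain i where i: "i < n" "y = c i" using cycle_enum_obtain[OF assms(1,2)] .
  have "3 \<le> n" using assms(1) by (simp add: cycle_enum_iff)
  then have "i = Suc 0 mod n \<or> 0 = Suc i mod n"
    using assms i by (auto simp: cycle_enum_iff)
  then have "i = 1 \<or> i = n - 1"
    using i \<open>3 \<le> n\<close> by (auto simp: Suc_mod_lt split: if_splits)
  then show ?thesis using i by auto
qed

lemma cycle_enum_from_edge:
  assumes c: "cycle_enum E Y n c" and y: "y \<in> Y" "z \<in> Y" "{y, z} \<in> E"
  obtains c' where "cycle_enum E Y n c'" "c' 0 = y" "c' 1 = z"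
proof -
  obtain c1 where c1: "cycle_enum E Y n c1" "c1 0 = y"
    using cycle_enum_from_vertex[OF c y(1)] .
  have n: "3 \<le> n" using c by (simp add: cycle_enum_iff)
  consider "z = c1 1" | "z = c1 (n - 1)"
    using cycle_enum_neighbours_0[OF c1(1) y(2)] c1 y by auto
  then show ?thesis
  proof cases
    case 1
    then show ?thesis using that c1 by blast
  next
    case 2
    then show ?thesis
      using that[OF cycle_enum_reflect[OF c1(1)]] c1 n by auto
  qed
qed

lemma cycle_enum_Suc_edge:
  assumes "cycle_enum E Y n c" "Suc i < n"
  shows "{c i, c (Suc i)} \<in> E"
  using assms by (auto simp: cycle_enum_iff)

lemma cycle_enum_last_edge:
  assumes "cycle_enum E Y n c"
  shows "{c 0, c (n - 1)} \<in> E"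
proof -
  have "3 \<le> n" using assms by (simp add: cycle_enum_iff)
  then show ?thesis using assms by (auto simp: cycle_enum_iff)
qed

text \<open>The half turn, and the reflection flipping \<open>{c 0, c 1}\<close>. They allow an
  opposite pair of edges to be placed at indices \<open>0\<close>, \<open>1\<close>,
  \<open>m\<close>, \<open>m + 1\<close> with either edge first and in either direction.\<close>

lemma cycle_enum_antipodal_edges:
  assumes c: "cycle_enum E Y (2 * m) c"
  shows "\<exists>c'. cycle_enum E Y (2 * m) c' \<and> c' 0 = c m \<and> c' 1 = c (m + 1) \<and>
     c' m = c 0 \<and> c' (m + 1) = c 1"
    and "\<exists>c'. cycle_enum E Y (2 * m) c' \<and> c' 0 = c 1 \<and> c' 1 = c 0 \<and>
     c' m = c (m + 1) \<and> c' (m + 1) = c m"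
proof -
  have m: "2 \<le> m" using c by (simp add: cycle_enum_iff)
  have "cycle_enum E Y (2 * m) (\<lambda>i. c ((i + m) mod (2 * m)))"
    using m by (intro cycle_enum_rotate[OF c]) auto
  moreover have "(2 * m + 1) mod (2 * m) = 1" "(m + 1 + m) mod (2 * m) = 1"
    using m by (simp_all add: mod_if)
  ultimately show "\<exists>c'. cycle_enum E Y (2 * m) c' \<and> c' 0 = c m \<and> c' 1 = c (m + 1) \<and>
     c' m = c 0 \<and> c' (m + 1) = c 1"
    using m by (intro exI[of _ "\<lambda>i. c ((i + m) mod (2 * m))"]) (simp add: mult_2[symmetric])
  have "cycle_enum E Y (2 * m) (\<lambda>i. c ((i + 1) mod (2 * m)))"
    using m by (intro cycle_enum_rotate[OF c]) auto
  from cycle_enum_reflect[OF this]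
  have "cycle_enum E Y (2 * m) (\<lambda>i. c (((2 * m - i) mod (2 * m) + 1) mod (2 * m)))" .
  moreover have "((2 * m - m) mod (2 * m) + 1) mod (2 * m) = m + 1"
    "((2 * m - (m + 1)) mod (2 * m) + 1) mod (2 * m) = m" "(2 * m - 1) mod (2 * m) + 1 = 2 * m"
    using m by (simp_all add: mod_if)
  ultimately show "\<exists>c'. cycle_enum E Y (2 * m) c' \<and> c' 0 = c 1 \<and> c' 1 = c 0 \<and>
     c' m = c (m + 1) \<and> c' (m + 1) = c m"
    using m
    by (intro exI[of _ "\<lambda>i. c (((2 * m - i) mod (2 * m) + 1) mod (2 * m))"]) simp
qed

lemma cycle_enum_triangle:
  assumes "{x, y} \<in> E" "{x, z} \<in> E" "{y, z} \<in> E" "\<And>u. {u} \<notin> E"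
  shows "\<exists>c. cycle_enum E {x, y, z} 3 c"
proof
  let ?c = "\<lambda>i::nat. if i = 0 then x else if i = 1 then y else z"
  have lt: "{..<3} = {0::nat, 1, 2}" by auto
  have neq: "x \<noteq> y" "x \<noteq> z" "y \<noteq> z" using assms by auto
  have *: "{y, x} \<in> E" "{z, x} \<in> E" "{z, y} \<in> E" using assms by (simp_all add: insert_commute)
  have "{?c i, ?c j} \<in> E \<longleftrightarrow> j = Suc i mod 3 \<or> i = Suc j mod 3" if "i < 3" "j < 3" for i j
  proof -
    have "i = 0 \<or> i = 1 \<or> i = 2" "j = 0 \<or> j = 1 \<or> j = 2" using that by auto
    then show ?thesis by (elim disjE) (simp_all add: assms *)
  qed
  moreover have "bij_betw ?c {..<3} {x, y, z}"
    using neq by (auto simp: bij_betw_def lt inj_on_def)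
  ultimately show "cycle_enum E {x, y, z} 3 ?c" by (simp add: cycle_enum_iff)
qed

lemma cycle_enum_3_edge:
  assumes "cycle_enum E Y 3 c" "x \<in> Y" "y \<in> Y" "x \<noteq> y"
  shows "{x, y} \<in> E"
proof -
  obtain i j where "i < 3" "j < 3" "x = c i" "y = c j"
    using cycle_enum_obtain[OF assms(1)] assms(2,3) by metis
  moreover from this assms(4) have "i \<noteq> j" by auto
  then have "j = Suc i mod 3 \<or> i = Suc j mod 3"
    using \<open>i < 3\<close> \<open>j < 3\<close> by (auto simp: mod_if)
  ultimately show ?thesis using assms(1) by (auto simp: cycle_enum_iff)
qed

section \<open>Opposite edges and the equivalence relation behind hyperplanes\<close>

lemma opposite_edges_iff:
  "opposite_edges E Y e e' \<longleftrightarrow>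
     (\<exists>m c. cycle_enum E Y (2 * m) c \<and> e = {c 0, c 1} \<and> e' = {c m, c (m + 1)})"
proof
  assume "opposite_edges E Y e e'"
  then obtain m c i where c: "cycle_enum E Y (2 * m) c" "i < 2 * m"
    "e = {c i, c (Suc i mod (2 * m))}"
    "e' = {c ((i + m) mod (2 * m)), c (Suc (i + m) mod (2 * m))}"
    unfolding opposite_edges_def by blast
  \<comment> \<open>Rotating by \<open>i\<close> moves the first edge to indices \<open>0\<close>
    and \<open>1\<close>, and the residues in the definition disappear.\<close>
  have "cycle_enum E Y (2 * m) (\<lambda>j. c ((j + i) mod (2 * m)))"
    using cycle_enum_rotate[OF c(1,2)] .
  then show "\<exists>m c. cycle_enum E Y (2 * m) c \<and> e = {c 0, c 1} \<and> e' = {c m, c (m + 1)}"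
    using c(2-4)
    by (intro exI[of _ m] exI[of _ "\<lambda>j. c ((j + i) mod (2 * m))"]) (simp add: add.commute)
next
  assume "\<exists>m c. cycle_enum E Y (2 * m) c \<and> e = {c 0, c 1} \<and> e' = {c m, c (m + 1)}"
  then obtain m c where c: "cycle_enum E Y (2 * m) c" "e = {c 0, c 1}" "e' = {c m, c (m + 1)}"
    by blast
  then have "2 \<le> m" by (simp add: cycle_enum_iff)
  then show "opposite_edges E Y e e'"
    unfolding opposite_edges_def using c
    by (intro exI[of _ m] exI[of _ c] exI[of _ 0]) simp
qed

lemma opposite_edges_sym: "opposite_edges E Y e e' \<Longrightarrow> opposite_edges E Y e' e"
  unfolding opposite_edges_iff using cycle_enum_antipodal_edges(1) by metis

lemma edge_rel_sym: "sym (edge_rel V E)"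
  unfolding sym_def edge_rel_def using opposite_edges_sym by blast

lemma equiv_edge_rel_rtrancl: "equiv UNIV ((edge_rel V E)\<^sup>*)"
  by (intro equivI) (auto simp: refl_rtrancl trans_rtrancl sym_rtrancl edge_rel_sym)

definition hyperplane_of :: "'a set \<Rightarrow> 'a set set \<Rightarrow> 'a set \<Rightarrow> 'a set set" where
  "hyperplane_of V E e = (edge_rel V E)\<^sup>* `` {e}"

lemma hyperplane_of_in: "e \<in> E \<Longrightarrow> hyperplane_of V E e \<in> hyperplanes V E"
  by (auto simp: hyperplane_of_def hyperplanes_def quotient_def)

lemma mem_hyperplane_of: "e \<in> hyperplane_of V E e"
  by (simp add: hyperplane_of_def)

lemma hyperplane_eq:
  assumes "J \<in> hyperplanes V E" "e \<in> J"
  shows "J = hyperplane_of V E e"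
proof -
  obtain e0 where "J = (edge_rel V E)\<^sup>* `` {e0}"
    using assms(1) by (auto simp: hyperplanes_def quotient_def)
  then show ?thesis
    using assms(2) equiv_class_eq[OF equiv_edge_rel_rtrancl] by (simp add: hyperplane_of_def)
qed

lemma hyperplane_subset:
  assumes "J \<in> hyperplanes V E"
  shows "J \<subseteq> E"
proof -
  have "e' \<in> E" if "(e, e') \<in> (edge_rel V E)\<^sup>*" "e \<in> E" for e e'
    using that by (induction rule: rtrancl_induct) (auto simp: edge_rel_def)
  then show ?thesis
    using assms by (auto simp: hyperplanes_def quotient_def)
qed

lemma hyperplane_nonempty: "J \<in> hyperplanes V E \<Longrightarrow> J \<noteq> {}"
  by (auto simp: hyperplanes_def quotient_def)

subsection \<open>Paths and distances\<close>

lemma joins_Cons: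
  "{x, y} \<in> F \<Longrightarrow> x \<in> V \<Longrightarrow> joins V F p y z \<Longrightarrow> joins V F (x # p) x z"
  by (cases p) (auto simp: joins_def graph_path_def)

lemma joins_rev: "joins V F p x y \<Longrightarrow> joins V F (rev p) y x"
  by (simp add: joins_def graph_path_def hd_rev last_rev insert_commute)

lemma joins_trans:
  assumes "joins V F p x y" "joins V F q y z"
  shows "\<exists>r. joins V F r x z"
proof -
  have "successively (\<lambda>x y. {x, y} \<in> F) p \<Longrightarrow> p \<noteq> [] \<Longrightarrow> set p \<subseteq> V \<Longrightarrow> last p = y
    \<Longrightarrow> \<exists>r. joins V F r (hd p) z"
  proof (induction p)
    case (Cons u p)
    show ?case
    proof (cases p)
      case Nil
      then show ?thesis using Cons assms(2) by auto
    next
      case (Cons v p')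
      then show ?thesis
        using Cons.IH Cons.prems joins_Cons[of u v F V _ z] by auto
    qed
  qed simp
  then show ?thesis using assms(1) by (auto simp: joins_def graph_path_def)
qed

lemma joins_invariant:
  assumes "joins V F p x y" "\<And>u v. {u, v} \<in> F \<Longrightarrow> g u = g v"
  shows "g x = g y"
proof -
  have "successively (\<lambda>x y. {x, y} \<in> F) p \<Longrightarrow> p \<noteq> [] \<Longrightarrow> g (hd p) = g (last p)"
  proof (induction p)
    case (Cons u p)
    show ?case
    proof (cases "p = []")
      case False
      then have "{u, hd p} \<in> F" "g (hd p) = g (last p)"
        using Cons by (auto simp: successively_Cons)
      then show ?thesis using assms(2)[of u "hd p"] False by simp
    qed simp
  qed simp
  then show ?thesis using assms(1) by (metis graph_path_def joins_def)
qed

lemma crossings_le_1_iff: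
  "crossings p J \<le> 1 \<longleftrightarrow>
     (\<forall>i j. i < j \<and> Suc j < length p \<and> {p ! i, p ! Suc i} \<in> J \<longrightarrow> {p ! j, p ! Suc j} \<notin> J)"
    (is "_ \<longleftrightarrow> ?once")
proof -
  let ?A = "{i. Suc i < length p \<and> {p ! i, p ! Suc i} \<in> J}"
  have "finite ?A" by (rule finite_subset[of _ "{..<length p}"]) auto
  from card_le_Suc0_iff_eq[OF this]
  have "crossings p J \<le> 1 \<longleftrightarrow> (\<forall>i\<in>?A. \<forall>j\<in>?A. i = j)"
    by (simp add: crossings_def)
  also have "\<dots> \<longleftrightarrow> ?once"
  proof
    assume eq: "\<forall>i\<in>?A. \<forall>j\<in>?A. i = j"
    show ?once
    proof (intro allI impI notI)
      fix i j
      assume "i < j \<and> Suc j < length p \<and> {p ! i, p ! Suc i} \<in> J" "{p ! j, p ! Suc j} \<in> J"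
      then have ij: "i \<in> ?A" "j \<in> ?A" and "i < j" by auto
      from bspec[OF bspec[OF eq ij(1)] ij(2)] \<open>i < j\<close> show False by simp
    qed
  next
    assume once: ?once
    show "\<forall>i\<in>?A. \<forall>j\<in>?A. i = j"
    proof (intro ballI)
      fix i j assume "i \<in> ?A" "j \<in> ?A"
      then show "i = j" using once by (cases i j rule: linorder_cases) auto
    qed
  qed
  finally show ?thesis .
qed

section \<open>The graph metric, geodesics and intervals\<close>

locale connected_simplicial_graph =
  fixes V :: "'a set" and E :: "'a set set"
  assumes simplicial: "simplicial_graph V E" and connected: "connected_graph V E"
begin

abbreviation d :: "'a \<Rightarrow> 'a \<Rightarrow> nat" where "d \<equiv> gdist V E"

lemma edgeD:
  assumes "{x, y} \<in> E"
  shows "x \<in> V" "y \<in> V" "x \<noteq> y"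
  using assms simplicial unfolding simplicial_graph_def by (force simp: doubleton_eq_iff)+

lemma edgeE:
  assumes "e \<in> E"
  obtains x y where "e = {x, y}" "x \<in> V" "y \<in> V" "x \<noteq> y"
  using assms simplicial unfolding simplicial_graph_def by blast

lemma edge_sym: "{x, y} \<in> E \<Longrightarrow> {y, x} \<in> E"
  by (simp add: insert_commute)

lemma dist_le: "joins V E p x y \<Longrightarrow> length p = Suc n \<Longrightarrow> d x y \<le> n"
  unfolding gdist_def by (blast intro: Least_le)

lemma shortest_path:
  assumes "x \<in> V" "y \<in> V"
  obtains p where "joins V E p x y" "length p = Suc (d x y)"
proof -
  obtain p where p: "joins V E p x y"
    using assms connected by (auto simp: connected_graph_def)
  then have "length p = Suc (length p - 1)"
    by (cases p) (auto simp: joins_def graph_path_def)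
  with p have "\<exists>n p. joins V E p x y \<and> length p = Suc n" by blast
  from LeastI_ex[OF this] show ?thesis
    using that by (auto simp: gdist_def)
qed

lemma dist_edge_le: "{x, y} \<in> E \<Longrightarrow> z \<in> V \<Longrightarrow> d x z \<le> Suc (d y z)"
  by (metis dist_le edgeD(1,2) joins_Cons length_Cons shortest_path)

lemma dist_refl [simp]: "x \<in> V \<Longrightarrow> d x x = 0"
  using dist_le[of "[x]" x x 0] by (simp add: joins_def graph_path_def)

lemma dist_Suc:
  assumes "x \<in> V" "y \<in> V" "d x y = Suc n"
  obtains z where "{x, z} \<in> E" "d z y = n"
proof -
  obtain p where p: "joins V E p x y" "length p = Suc (Suc n)"
    using shortest_path[OF assms(1,2)] assms(3) by metis
  then obtain z q where q: "p = x # z # q"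
    by (cases p; cases "tl p") (auto simp: joins_def)
  then have xz: "{x, z} \<in> E" and "joins V E (z # q) z y"
    using p by (auto simp: joins_def graph_path_def)
  then have "d z y \<le> n"
    using dist_le p q by force
  moreover have "Suc n \<le> Suc (d z y)"
    using dist_edge_le[OF xz assms(2)] assms(3) by simp
  ultimately show ?thesis using that xz by simp
qed

lemma dist_eq_0:
  assumes "x \<in> V" "y \<in> V" "d x y = 0"
  shows "x = y"
proof -
  obtain p where "joins V E p x y" "length p = Suc 0"
    using shortest_path[OF assms(1,2)] assms(3) by metis
  then show ?thesis
    by (auto simp: joins_def length_Suc_conv)
qed

lemma dist_triangle:
  assumes "x \<in> V" "y \<in> V" "z \<in> V"
  shows "d x z \<le> d x y + d y z"
  using assms(1)
proof (induction "d x y" arbitrary: x)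
  case 0
  then show ?case using dist_eq_0 assms by auto
next
  case (Suc n)
  then obtain u where u: "{x, u} \<in> E" "d u y = n"
    using dist_Suc assms(2) by metis
  then show ?case
    using Suc dist_edge_le[OF u(1) assms(3)] edgeD[OF u(1)] by force
qed

lemma dist_edge_1: "{x, y} \<in> E \<Longrightarrow> d x y = 1"
  using dist_edge_le[of x y y] dist_eq_0[of x y] edgeD[of x y] by fastforce

lemma dist_sym:
  assumes "x \<in> V" "y \<in> V"
  shows "d x y = d y x"
proof -
  have "d y x \<le> d x y" if xy: "x \<in> V" "y \<in> V" for x y
    using xy(1)
  proof (induction "d x y" arbitrary: x)
    case 0
    then show ?case using dist_eq_0 xy by auto
  next
    case (Suc n)
    then obtain u where u: "{x, u} \<in> E" "d u y = n"
      using dist_Suc xy(2) by metis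
    then have "d y x \<le> d y u + d u x" and "d u x = 1" and "d y u \<le> n"
      using Suc dist_triangle[of y u x] xy(2) edgeD[OF u(1)] dist_edge_1[of u x]
      by (auto simp: insert_commute)
    then show ?case using Suc by simp
  qed
  then show ?thesis using assms by (simp add: le_antisym)
qed

lemma dist_edge_bounds:
  assumes "{y, z} \<in> E" "x \<in> V"
  shows "d x y \<le> Suc (d x z)" "d x z \<le> Suc (d x y)"
  using assms dist_edge_le[of y z x] dist_edge_le[of z y x] edgeD[OF assms(1)]
  by (auto simp: dist_sym insert_commute)

lemma path_edge: "graph_path V E p \<Longrightarrow> Suc i < length p \<Longrightarrow> {p ! i, p ! Suc i} \<in> E"
  by (simp add: graph_path_def successively_conv_nth)

lemma path_in_V: "graph_path V E p \<Longrightarrow> i < length p \<Longrightarrow> p ! i \<in> V"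
  by (auto simp: graph_path_def)

lemma path_dist_le:
  assumes "graph_path V E p" "i \<le> j" "j < length p"
  shows "d (p ! i) (p ! j) \<le> j - i"
  using assms(2,3)
proof (induction j rule: dec_induct)
  case base
  then show ?case using path_in_V[OF assms(1)] by simp
next
  case (step j)
  then show ?case
    using dist_edge_bounds(2)[OF path_edge[OF assms(1)], of j "p ! i"] path_in_V[OF assms(1), of i]
    by simp
qed

text \<open>Cutting the path at \<open>i\<close> and \<open>j\<close>, no piece has distance above
  its number of edges, while the triangle inequality makes the three distances add up to at least
  the full length. So every bound is attained.\<close>

lemma geodesic_dist:
  assumes "geodesic V E p" "i \<le> j" "j < length p"
  shows "d (p ! i) (p ! j) = j - i"
proof -
  have p: "graph_path V E p" using assms(1) by (simp add: geodesic_def)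
  let ?n = "length p - 1"
  have "p \<noteq> []" using assms(3) by auto
  then have "length p = Suc (d (p ! 0) (p ! ?n))"
    using assms(1) unfolding geodesic_def by (metis hd_conv_nth last_conv_nth)
  then have "d (p ! 0) (p ! ?n) = ?n" by linarith
  moreover have "d (p ! 0) (p ! ?n) \<le> d (p ! 0) (p ! i) + (d (p ! i) (p ! j) + d (p ! j) (p ! ?n))"
    using dist_triangle[of "p ! 0" "p ! i" "p ! ?n"] dist_triangle[of "p ! i" "p ! j" "p ! ?n"]
      path_in_V[OF p] assms by fastforce
  ultimately show ?thesis
    using path_dist_le[OF p, of 0 i] path_dist_le[OF p assms(2,3)] path_dist_le[OF p, of j ?n] assms(2,3)
    by linarith
qed

lemma mem_intervalI:
  assumes "x \<in> V" "y \<in> V" "z \<in> V" "d x z + d z y \<le> d x y"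
  shows "z \<in> interval V E x y"
  using assms dist_triangle[of x z y] by (simp add: interval_def)

lemma convex_subgraphD:
  assumes "convex_subgraph V E Y" "x \<in> Y" "y \<in> Y" "z \<in> V" "d x z + d z y \<le> d x y"
  shows "z \<in> Y"
  using assms mem_intervalI[of x y z] unfolding convex_subgraph_def by blast

section \<open>Distances inside convex cycles\<close>

lemma dist_cycle_0:
  assumes Y: "convex_subgraph V E Y" and c: "cycle_enum E Y n c" and "i < n"
  shows "d (c 0) (c i) = min i (n - i)"
proof (rule antisym)
  have V: "c j \<in> V" if "j < n" for j
    using cycle_enum_mem[OF c that] Y by (auto simp: convex_subgraph_def)
  have n: "3 \<le> n" using c by (simp add: cycle_enum_iff)
  \<comment> \<open>The upper bound comes from walking around the cycle in each of the two
    directions.\<close>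
  have "d (c 0) (c j) \<le> j" if "j < n" for j
    using that
  proof (induction j)
    case (Suc j)
    then show ?case
      using dist_edge_bounds(2)[OF cycle_enum_Suc_edge[OF c Suc.prems], of "c 0"] V[of 0] by auto
  qed (use V n in auto)
  moreover have "d (c 0) (c (n - j)) \<le> j" if "0 < j" "j \<le> n" for j
    using that(2,1)
  proof (induction j rule: nat_induct)
    case (Suc j)
    show ?case
    proof (cases "j = 0")
      case True
      then show ?thesis using dist_edge_1[OF cycle_enum_last_edge[OF c]] by simp
    next
      case False
      have "{c (n - Suc j), c (n - j)} \<in> E"
        using cycle_enum_Suc_edge[OF c, of "n - Suc j"] Suc.prems False by (simp add: Suc_diff_Suc)
      then show ?thesis
        using dist_edge_bounds(1)[of _ _ "c 0"] V[of 0] n Suc False by fastforce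
    qed
  qed simp
  from this[of "n - i"] have "d (c 0) (c i) \<le> n - i" using \<open>i < n\<close> by simp
  ultimately show "d (c 0) (c i) \<le> min i (n - i)" using \<open>i < n\<close> by simp
  \<comment> \<open>For the lower bound, convexity keeps the first step of a geodesic from
    \<open>c i\<close> to \<open>c 0\<close> inside \<open>Y\<close>, so that step leads to a cyclic
    neighbour of \<open>c i\<close>.\<close>
  show "min i (n - i) \<le> d (c 0) (c i)"
    using \<open>i < n\<close>
  proof (induction "d (c 0) (c i)" arbitrary: i)
    case 0
    then show ?case
      using dist_eq_0[of "c 0" "c i"] V[of 0] V[of i] n cycle_enum_eq_iff[OF c, of 0 i] by auto
  next
    case (Suc k)
    have V': "c 0 \<in> V" "c i \<in> V" using V n Suc.prems by auto
    obtain z where z: "{c i, z} \<in> E" "d z (c 0) = k"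
      using dist_Suc[OF V'(2,1)] Suc.hyps(2) V' by (metis dist_sym)
    have zV: "z \<in> V" using edgeD[OF z(1)] by simp
    have "z \<in> Y"
      using convex_subgraphD[OF Y cycle_enum_mem[OF c, of i] cycle_enum_mem[OF c, of 0] zV]
        Suc.hyps(2) Suc.prems n z dist_edge_1[OF z(1)] V' by (simp add: dist_sym)
    then obtain j where j: "j < n" "z = c j" using cycle_enum_obtain[OF c] by blast
    then have "min j (n - j) \<le> k"
      using Suc.hyps(1)[of j] z V' zV by (metis dist_sym)
    moreover have "j = Suc i mod n \<or> i = Suc j mod n"
      using z(1) j Suc.prems c by (simp add: cycle_enum_iff)
    ultimately show ?case
      using j Suc.prems Suc.hyps(2) by (auto simp: Suc_mod_lt split: if_splits)
  qed
qed

lemma dist_cycle: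
  assumes Y: "convex_subgraph V E Y" and c: "cycle_enum E Y n c" and "i \<le> j" "j < n"
  shows "d (c i) (c j) = min (j - i) (n - (j - i))"
  using dist_cycle_0[OF Y cycle_enum_rotate[OF c, of i], of "j - i"] assms by simp

lemma convex_cycle_subset: "convex_subgraph V E Y \<Longrightarrow> cycle_enum E Y n c \<Longrightarrow> i < n \<Longrightarrow> c i \<in> V"
  using cycle_enum_mem by (fastforce simp: convex_subgraph_def)

text \<open>Distances in a convex cycle are cyclic distances, so antipodes are \<open>m\<close>
  apart and each vertex lies on one of the two halves joining them.\<close>

lemma dist_antipodes:
  assumes Y: "convex_subgraph V E Y" and c: "cycle_enum E Y (2 * m) c"
    and "i < m" "z \<in> Y"
  shows "d z (c i) + d z (c (i + m)) = m"
proof -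
  obtain j where j: "j < 2 * m" "z = c j" using cycle_enum_obtain[OF c \<open>z \<in> Y\<close>] .
  have *: "d (c j) (c k) = min (k - j) (2 * m - (k - j))" if "j \<le> k" "k < 2 * m" for k
    using dist_cycle[OF Y c that] .
  have **: "d (c j) (c k) = min (j - k) (2 * m - (j - k))" if "k \<le> j" for k
    using dist_cycle[OF Y c that j(1)] convex_cycle_subset[OF Y c] that j(1)
    by (simp add: dist_sym)
  consider "j \<le> i" | "i \<le> j" "j \<le> i + m" | "i + m \<le> j" by linarith
  then show ?thesis
    using j(1) \<open>i < m\<close> unfolding j(2) by cases (auto simp: * **)
qed

lemma convex_cycle_no_triangle:
  assumes Y: "convex_subgraph V E Y" and c: "cycle_enum E Y n c" "4 \<le> n"
    and "x \<in> Y" "y \<in> Y" "z \<in> Y" "{x, y} \<in> E" "{x, z} \<in> E"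
  shows "{y, z} \<notin> E"
proof -
  obtain c' where c': "cycle_enum E Y n c'" "c' 0 = x" "c' 1 = y"
    using cycle_enum_from_edge[OF c(1)] assms by metis
  then have "z = y \<or> z = c' (n - 1)"
    using cycle_enum_neighbours_0[OF c'(1)] assms by auto
  moreover have "d (c' 1) (c' (n - 1)) = 2"
    using dist_cycle[OF Y c'(1), of 1 "n - 1"] c(2) by simp
  ultimately show ?thesis
    using edgeD(3)[of y z] dist_edge_1[of y z] c' by auto
qed

end

subsection \<open>Even cycles in mediangle graphs\<close>

locale mediangle =
  fixes V :: "'a set" and E :: "'a set set"
  assumes mediangle: "mediangle_graph V E"

sublocale mediangle \<subseteq> connected_simplicial_graph
  by unfold_locales (use mediangle in \<open>auto simp: mediangle_graph_def\<close>)

context mediangle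
begin

section \<open>The mediangle axioms in usable form\<close>

lemma triangle_cond:
  assumes "w \<in> V" "{x, y} \<in> E" "d w x = d w y"
  obtains z where "{x, z} \<in> E" "{y, z} \<in> E" "Suc (d w z) = d w x"
proof -
  have "triangle_condition V E" using mediangle by (simp add: mediangle_graph_def)
  then obtain z where z: "{x, z} \<in> E" "{y, z} \<in> E" "z \<in> interval V E w x"
    using assms edgeD[OF assms(2)] dist_edge_1[OF assms(2)] unfolding triangle_condition_def by blast
  then have "Suc (d w z) = d w x"
    using dist_edge_1[OF edge_sym[OF z(1)]] by (simp add: interval_def)
  then show ?thesis using that z by blast
qed

lemma no_K4_minus:
  assumes "x \<noteq> y" "{x, z} \<in> E" "{y, z} \<in> E" "{x, w} \<in> E" "{y, w} \<in> E" "{z, w} \<in> E"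
  shows "{x, y} \<in> E"
proof (rule ccontr)
  assume xy: "{x, y} \<notin> E"
  define f :: "nat \<Rightarrow> 'a" where "f = (\<lambda>i. if i = 0 then x else if i = 1 then y else if i = 2 then z else w)"
  have neq: "x \<noteq> z" "x \<noteq> w" "y \<noteq> z" "y \<noteq> w" "z \<noteq> w"
    using assms edgeD by blast+
  have lt4: "{..<4} = {0::nat, 1, 2, 3}" by auto
  have K4: "{i, j} \<in> K4_minus_edges \<longleftrightarrow> i \<noteq> j \<and> {i, j} \<noteq> {0, 1}" if "i < 4" "j < 4" for i j
  proof -
    have "{i, j} \<in> {{i, j} | i j. i < 4 \<and> j < 4 \<and> i \<noteq> j} \<longleftrightarrow> i \<noteq> j"
      using that by (auto simp: doubleton_eq_iff)
    then show ?thesis unfolding K4_minus_edges_def by blast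
  qed
  have noloop: "{u} \<notin> E" for u
    using edgeD(3)[of u u] by auto
  have sym: "{z, x} \<in> E" "{z, y} \<in> E" "{w, x} \<in> E" "{w, y} \<in> E" "{w, z} \<in> E" "{y, x} \<notin> E"
    using assms(2-) xy by (simp_all add: insert_commute)
  have "graph_iso f {..<4} K4_minus_edges {x, y, z, w} (induced_edges E {x, y, z, w})"
    unfolding graph_iso_def
  proof (intro conjI ballI)
    show "bij_betw f {..<4} {x, y, z, w}"
      using neq assms(1) by (auto simp: bij_betw_def f_def lt4 inj_on_def)
    fix i j :: nat
    assume "i \<in> {..<4}" "j \<in> {..<4}"
    then have "i < 4" "j < 4" and ij: "i = 0 \<or> i = 1 \<or> i = 2 \<or> i = 3" "j = 0 \<or> j = 1 \<or> j = 2 \<or> j = 3"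
      by auto
    have "{f i, f j} \<in> induced_edges E {x, y, z, w} \<longleftrightarrow> {f i, f j} \<in> E"
      by (auto simp: f_def induced_edges_def)
    then show "{i, j} \<in> K4_minus_edges \<longleftrightarrow> {f i, f j} \<in> induced_edges E {x, y, z, w}"
      unfolding K4[OF \<open>i < 4\<close> \<open>j < 4\<close>]
      using ij by (elim disjE) (use assms(2-) xy sym noloop in \<open>simp_all add: f_def doubleton_eq_iff\<close>)
  qed
  moreover have "{x, y, z, w} \<subseteq> V" using assms edgeD by blast
  moreover have "intersection_of_triangles V E" using mediangle by (simp add: mediangle_graph_def)
  ultimately show False unfolding intersection_of_triangles_def by blast
qed

text \<open>The triangle condition gives a common neighbour \<open>w\<close> of \<open>x\<close> and
  \<open>y\<close> nearer to \<open>o'\<close>. If \<open>z\<close> were farther, \<open>z\<close>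
  and \<open>w\<close> would be distinct, hence adjacent for want of a K4 minus an edge, although
  their distances to \<open>o'\<close> differ by two.\<close>

lemma triangle_dist:
  assumes "o' \<in> V" "{x, y} \<in> E" "{x, z} \<in> E" "{y, z} \<in> E" "d o' x = d o' y"
  shows "d o' z \<noteq> Suc (d o' x)"
proof
  assume z: "d o' z = Suc (d o' x)"
  obtain w where w: "{x, w} \<in> E" "{y, w} \<in> E" "Suc (d o' w) = d o' x"
    using triangle_cond[OF assms(1,2,5)] .
  then have "z \<noteq> w" using z by auto
  then have "{z, w} \<in> E"
    using no_K4_minus[of z w x y] w assms by (auto simp: insert_commute)
  then show False
    using dist_edge_bounds(1)[OF _ assms(1), of z w] w z by simp
qed

lemma convex_cycles_eq:
  assumes "convex_even_cycle V E Y" "convex_even_cycle V E Z"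
    and "{x, y} \<in> E" "{x, z} \<in> E" "y \<noteq> z" "{x, y, z} \<subseteq> Y" "{x, y, z} \<subseteq> Z"
  shows "Y = Z"
proof (rule ccontr)
  assume "Y \<noteq> Z"
  moreover have "intersection_of_even_cycles V E" using mediangle by (simp add: mediangle_graph_def)
  ultimately have "\<forall>e\<in>induced_edges E (Y \<inter> Z). \<forall>e'\<in>induced_edges E (Y \<inter> Z). e = e'"
    using assms(1,2) by (simp add: intersection_of_even_cycles_def)
  moreover have "{x, y} \<in> induced_edges E (Y \<inter> Z)" "{x, z} \<in> induced_edges E (Y \<inter> Z)"
    using assms by (auto simp: induced_edges_def)
  ultimately have "{x, y} = {x, z}" by metis
  then show False using assms(5) by (auto simp: doubleton_eq_iff)
qed

text \<open>The cycle condition in normalised form: the enumeration starts at \<open>z\<close> with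
  \<open>x\<close> and \<open>y\<close> on either side, and \<open>c m\<close> is the opposite
  vertex, nearer to \<open>w\<close> than \<open>z\<close> by exactly \<open>m\<close>.\<close>

lemma cycle_cond:
  assumes "w \<in> V" "{z, x} \<in> E" "{z, y} \<in> E" "x \<noteq> y" "Suc (d w x) = d w z" "Suc (d w y) = d w z"
  obtains Y m c where "convex_even_cycle V E Y" "cycle_enum E Y (2 * m) c" "2 \<le> m"
    "c 0 = z" "c 1 = x" "c (2 * m - 1) = y" "d w (c m) + m = d w z"
proof -
  have V: "x \<in> V" "y \<in> V" "z \<in> V" using edgeD assms(2,3) by blast+
  have "cycle_condition V E" using mediangle by (simp add: mediangle_graph_def)
  then obtain Y u where Y: "convex_even_cycle V E Y" "{z, x} \<in> induced_edges E Y"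
      "{z, y} \<in> induced_edges E Y" "opposite_vertices E Y z u" "u \<in> interval V E w x"
    using assms V dist_edge_1[OF assms(2)] dist_edge_1[OF assms(3)] dist_sym
    unfolding cycle_condition_def by (metis (no_types, lifting) IntD1 Suc_eq_plus1 add_right_imp_eq)
  then have conv: "convex_subgraph V E Y" by (simp add: convex_even_cycle_def)
  obtain m c i where c: "cycle_enum E Y (2 * m) c" "i < 2 * m" "z = c i" "u = c ((i + m) mod (2 * m))"
    using Y(4) unfolding opposite_vertices_def by blast
  have m: "2 \<le> m" using c(1) by (simp add: cycle_enum_iff)
  have in_Y: "x \<in> Y" "y \<in> Y" "z \<in> Y" using Y(2,3) by (auto simp: induced_edges_def)
  obtain c' where c': "cycle_enum E Y (2 * m) c'" "c' 0 = z" "c' 1 = x"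
    using cycle_enum_from_edge[OF c(1) in_Y(3,1) assms(2)] .
  have "y = c' (2 * m - 1)"
    using cycle_enum_neighbours_0[OF c'(1) in_Y(2)] assms(3,4) c' by auto
  have "cycle_enum E Y (2 * m) (\<lambda>j. c ((j + i) mod (2 * m)))"
    using cycle_enum_rotate[OF c(1,2)] .
  from dist_cycle_0[OF conv this, of m] have "d z u = m"
    using m c by (simp add: add.commute)
  have "u \<in> Y" using cycle_enum_mem[OF c(1)] c(4) m by simp
  then obtain k where k: "k < 2 * m" "u = c' k" using cycle_enum_obtain[OF c'(1)] by blast
  \<comment> \<open>The opposite vertex \<open>u\<close> came with another enumeration; its distance
    \<open>m\<close> from \<open>z\<close> fixes its index in \<open>c'\<close>.\<close>
  have "min k (2 * m - k) = m"
    using dist_cycle_0[OF conv c'(1) k(1)] k c' \<open>d z u = m\<close> by simp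
  then have "k = m" using k by (auto simp: min_def split: if_splits)
  have "d (c' 1) (c' m) = m - 1"
    using dist_cycle[OF conv c'(1), of 1 m] m by (simp add: min_def)
  then have "d w u + m = d w z"
    using Y(5) V m assms(5) c' k \<open>k = m\<close> by (simp add: interval_def dist_sym)
  then show ?thesis
    using that[OF Y(1) c'(1) m] c' k \<open>k = m\<close> \<open>y = c' (2 * m - 1)\<close> by simp
qed

text \<open>
  Suppose \<open>m \<ge> 3\<close> and let \<open>{c 0, c 1}\<close> be the edge of \<open>Y\<close> opposite to \<open>{x, y}\<close>. The triangle
  condition seen from \<open>t\<close> yields a triangle \<open>c 0\<close>, \<open>c 1\<close>, \<open>t'\<close>, and the cycle condition at \<open>c 0\<close>
  a convex cycle \<open>Z\<close> of length \<open>2 * n \<le> 2 * m\<close> through the triangle edge \<open>{c 0, t'}\<close> and the edge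
  of \<open>Y\<close> at \<open>c 0\<close> other than \<open>{c 0, c 1}\<close>. The induction hypothesis leaves two cases: \<open>Z\<close> is a
  square, and then a third triangle meets \<open>Y\<close> impossibly, or \<open>n = m\<close>, and then \<open>Z\<close> shares two
  edges with \<open>Y\<close>.
\<close>

lemma triangle_edge_in_square:
  assumes "convex_even_cycle V E Y" "cycle_enum E Y (2 * m) c"
    and "x \<in> Y" "y \<in> Y" "{x, y} \<in> E" "{x, t} \<in> E" "{y, t} \<in> E"
  shows "m = 2"
  using assms
proof (induction m arbitrary: Y c x y t rule: less_induct)
  case (less m)
  note Y = less.prems(1)
  have Yc: "convex_subgraph V E Y" using Y by (simp add: convex_even_cycle_def)
  show ?case
  proof (rule ccontr)
    assume "m \<noteq> 2"
    moreover have "2 \<le> m" using less.prems(2) by (simp add: cycle_enum_iff)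
    ultimately have m: "3 \<le> m" by simp
    obtain c0 where c0: "cycle_enum E Y (2 * m) c0" "c0 0 = x" "c0 1 = y"
      using cycle_enum_from_edge[OF less.prems(2-5)] .
    then obtain c where c: "cycle_enum E Y (2 * m) c" "c m = x" "c (m + 1) = y"
      using cycle_enum_antipodal_edges(1)[OF c0(1)] by metis
    have V: "c i \<in> V" if "i < 2 * m" for i using convex_cycle_subset[OF Yc c(1) that] .
    have CV: "c 0 \<in> V" "c 1 \<in> V" "c m \<in> V" "c (m + 1) \<in> V" "c (2 * m - 1) \<in> V" "t \<in> V"
      using V m edgeD[OF less.prems(6)] by auto
    have D: "d (c i) (c j) = min (j - i) (2 * m - (j - i))" if "i \<le> j" "j < 2 * m" for i j
      using dist_cycle[OF Yc c(1) that] .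
    have e01: "{c 0, c 1} \<in> E" using cycle_enum_Suc_edge[OF c(1), of 0] m by simp
    have elast: "{c 0, c (2 * m - 1)} \<in> E" using cycle_enum_last_edge[OF c(1)] .
    have tri: "{c m, c (m + 1)} \<in> E" "{c m, t} \<in> E" "{c (m + 1), t} \<in> E"
      using less.prems c by auto
    have d0: "d (c 0) (c m) = m" "d (c 0) (c (m + 1)) = m - 1"
      using D[of 0 m] D[of 0 "m + 1"] m by auto
    have d1: "d (c 1) (c m) = m - 1" "d (c 1) (c (m + 1)) = m"
      using D[of 1 m] D[of 1 "m + 1"] m by auto
    \<comment> \<open>At distance \<open>m - 1\<close>, the vertex \<open>t\<close> would form with
      \<open>c (m + 1)\<close> an edge equidistant from \<open>c 0\<close> in a triangle whose third
      vertex \<open>c m\<close> is farther, against \<open>triangle_dist\<close>.\<close>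
    have "d (c 0) t = m"
    proof -
      have "d (c 0) t \<noteq> m - 1"
        using triangle_dist[OF CV(1), of "c (m + 1)" t "c m"] d0 m tri by (auto simp: insert_commute)
      then show ?thesis
        using dist_edge_bounds[OF tri(2) CV(1)] dist_edge_bounds[OF tri(3) CV(1)] d0 m by linarith
    qed
    moreover have "d (c 1) t = m"
    proof -
      have "d (c 1) t \<noteq> m - 1"
        using triangle_dist[OF CV(2), of "c m" t "c (m + 1)"] d1 m tri by (auto simp: insert_commute)
      then show ?thesis
        using dist_edge_bounds[OF tri(2) CV(2)] dist_edge_bounds[OF tri(3) CV(2)] d1 m by linarith
    qed
    ultimately have t01: "d t (c 0) = m" "d t (c 1) = m"
      using CV by (simp_all add: dist_sym)
    then obtain t' where t': "{c 0, t'} \<in> E" "{c 1, t'} \<in> E" "Suc (d t t') = m"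
      using triangle_cond[OF CV(6) e01] by metis
    have "d (c (m + 1)) (c (2 * m - 1)) = m - 2"
      using D[of "m + 1" "2 * m - 1"] m by auto
    then have "d t (c (2 * m - 1)) \<le> m - 1"
      using dist_triangle[of t "c (m + 1)" "c (2 * m - 1)"] CV m dist_edge_1[OF edge_sym[OF tri(3)]]
      by simp
    then have tl: "Suc (d t (c (2 * m - 1))) = m"
      using dist_edge_bounds(1)[OF elast CV(6)] t01 m by simp
    have d1l: "d (c 1) (c (2 * m - 1)) = 2"
      using D[of 1 "2 * m - 1"] m by auto
    have t'Y: "t' \<notin> Y"
      using convex_cycle_no_triangle[OF Yc c(1), of "c 0" "c 1" t'] t' e01 m
        cycle_enum_mem[OF c(1)] by auto
    then have "c (2 * m - 1) \<noteq> t'" using cycle_enum_mem[OF c(1), of "2 * m - 1"] m by auto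
    then obtain Z n e where Z: "convex_even_cycle V E Z" "cycle_enum E Z (2 * n) e" "2 \<le> n"
      "e 0 = c 0" "e 1 = c (2 * m - 1)" "e (2 * n - 1) = t'" "d t (e n) + n = d t (c 0)"
      using cycle_cond[OF CV(6) elast t'(1)] t01 tl t'(3) by metis
    then have Zc: "convex_subgraph V E Z" by (simp add: convex_even_cycle_def)
    have inZ: "c 0 \<in> Z" "c (2 * m - 1) \<in> Z" "t' \<in> Z" "e n \<in> Z"
      using cycle_enum_mem[OF Z(2), of 0] cycle_enum_mem[OF Z(2), of 1]
        cycle_enum_mem[OF Z(2), of "2 * n - 1"] cycle_enum_mem[OF Z(2), of n] Z(3-6) by auto
    have "n \<le> m" using Z(7) t01 by simp
    have "n < m \<Longrightarrow> n = 2"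
      using less.IH[OF _ Z(1,2) inZ(1,3) t'(1) e01] t'(2) by (simp add: insert_commute)
    then consider "n = 2" | "n = m" using \<open>n \<le> m\<close> by linarith
    then show False
    proof cases
      case 1
      have w: "{e 2, c (2 * m - 1)} \<in> E" "{e 2, t'} \<in> E"
        using cycle_enum_Suc_edge[OF Z(2), of 1] cycle_enum_Suc_edge[OF Z(2), of 2] 1 Z
        by (auto simp: numeral_2_eq_2 numeral_3_eq_3 insert_commute)
      have "e 2 \<in> V" using edgeD[OF w(1)] by simp
      have "d (c 1) (e 2) \<le> 2"
        using dist_edge_bounds(1)[OF w(2) CV(2)] dist_edge_1[OF t'(2)] by simp
      moreover have "d t (c 1) \<le> d t (e 2) + d (e 2) (c 1)"
        using dist_triangle CV \<open>e 2 \<in> V\<close> by blast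
      ultimately have "d (c 1) (e 2) = 2"
        using Z(7) 1 t01 CV \<open>e 2 \<in> V\<close> by (simp add: dist_sym)
      \<comment> \<open>Both ends of \<open>{e 2, c (2 * m - 1)}\<close> are at distance 2 from
        \<open>c 1\<close>. The new vertex \<open>s\<close> lies between \<open>c 1\<close> and
        \<open>c (2 * m - 1)\<close>, so convexity puts it in \<open>Y\<close> and it must be
        \<open>c 0\<close>. The edge from \<open>c 0\<close> to \<open>e 2\<close> would then be a
        diagonal of the square \<open>Z\<close>.\<close>
      then obtain s where s: "{e 2, s} \<in> E" "{c (2 * m - 1), s} \<in> E" "d (c 1) s = 1"
        using triangle_cond[OF CV(2) w(1)] d1l by (metis One_nat_def Suc_1 Suc_inject)
      have sV: "s \<in> V" using edgeD[OF s(1)] by simp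
      have "s \<in> Y"
        using convex_subgraphD[OF Yc _ _ sV, of "c 1" "c (2 * m - 1)"] cycle_enum_mem[OF c(1)] m
          d1l s dist_edge_1[OF edge_sym[OF s(2)]] by auto
      then obtain j where j: "j < 2 * m" "s = c j" using cycle_enum_obtain[OF c(1)] by blast
      have "j = 0"
      proof (rule ccontr)
        assume "j \<noteq> 0"
        then show False
          using D[of 1 j] D[of j "2 * m - 1"] j m s(3) dist_edge_1[OF edge_sym[OF s(2)]]
          by (auto simp: min_def split: if_splits)
      qed
      then have "d (e 0) (e 2) = 1"
        using j Z(4) dist_edge_1[OF edge_sym[OF s(1)]] by simp
      then show False
        using dist_cycle_0[OF Zc Z(2), of 2] 1 by simp
    next
      case 2
      \<comment> \<open>Here \<open>e n\<close> is \<open>t\<close> itself. Convexity of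
        \<open>Z\<close> then draws in \<open>c (m + 1)\<close> and \<open>c (2 * m - 2)\<close>,
        hence a second edge of \<open>Y\<close> at \<open>c (2 * m - 1)\<close>.\<close>
      then have "t \<in> Z"
        using Z(7) t01 dist_eq_0[of t "e n"] inZ CV Zc by (auto simp: convex_subgraph_def)
      then have m1: "c (m + 1) \<in> Z"
        using convex_subgraphD[OF Zc _ inZ(1) CV(4)] t01 m d0 CV
          dist_edge_1[OF edge_sym[OF tri(3)]] by (simp add: dist_sym)
      have "d (c (m + 1)) (c (2 * m - 2)) = m - 3" "d (c 0) (c (2 * m - 2)) = 2"
        using D[of "m + 1" "2 * m - 2"] D[of 0 "2 * m - 2"] m by auto
      then have "c (2 * m - 2) \<in> Z"
        using convex_subgraphD[OF Zc m1 inZ(1) V[of "2 * m - 2"]] d0 CV m V[of "2 * m - 2"]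
        by (simp add: dist_sym)
      moreover have "{c (2 * m - 1), c (2 * m - 2)} \<in> E"
        using cycle_enum_Suc_edge[OF c(1), of "2 * m - 2"] m
        by (simp add: insert_commute Suc_diff_Suc numeral_2_eq_2)
      moreover have "c 0 \<noteq> c (2 * m - 2)"
        using cycle_enum_eq_iff[OF c(1), of 0 "2 * m - 2"] m by simp
      ultimately have "Y = Z"
        using convex_cycles_eq[OF Y Z(1) edge_sym[OF elast], of "c (2 * m - 2)"]
          inZ cycle_enum_mem[OF c(1)] m by auto
      then show False using t'Y inZ by simp
    qed
  qed
qed

text \<open>The cycle condition at \<open>z\<close> yields a convex cycle through
  \<open>{z, p}\<close> and \<open>{z, q}\<close>, which must be \<open>Y\<close>. Its vertex
  opposite to \<open>z\<close> is nearer to \<open>x\<close> by half the length, so both halves of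
  \<open>Y\<close> descend geodesically from \<open>z\<close> towards \<open>x\<close>.\<close>

lemma peak:
  assumes "convex_even_cycle V E Y" "x \<in> V"
    and "{z, p, q} \<subseteq> Y" "{z, p} \<in> E" "{z, q} \<in> E" "p \<noteq> q" "d x p < d x z" "d x q < d x z"
    and "y \<in> Y"
  shows "d x y + d z y = d x z"
proof -
  have "Suc (d x p) = d x z" "Suc (d x q) = d x z"
    using dist_edge_bounds[OF assms(4,2)] dist_edge_bounds[OF assms(5,2)] assms by auto
  then obtain Z m c where Z: "convex_even_cycle V E Z" "cycle_enum E Z (2 * m) c" "2 \<le> m"
    "c 0 = z" "c 1 = p" "c (2 * m - 1) = q" "d x (c m) + m = d x z"
    using cycle_cond[OF assms(2,4,5,6)] by metis
  have Zc: "convex_subgraph V E Z" using Z by (simp add: convex_even_cycle_def)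
  have inZ: "{z, p, q} \<subseteq> Z"
    using cycle_enum_mem[OF Z(2), of 0] cycle_enum_mem[OF Z(2), of 1]
      cycle_enum_mem[OF Z(2), of "2 * m - 1"] Z by auto
  have "Y = Z"
    using convex_cycles_eq[OF assms(1) Z(1) assms(4-6) assms(3) inZ] .
  with \<open>y \<in> Y\<close> have y: "y \<in> Z" by simp
  have V: "y \<in> V" "z \<in> V" "c m \<in> V"
    using y inZ Zc cycle_enum_mem[OF Z(2), of m] Z(3) by (auto simp: convex_subgraph_def)
  have "d y z + d y (c m) = m"
    using dist_antipodes[OF Zc Z(2) _ y, of 0] Z by simp
  then show ?thesis
    using dist_triangle[of x "c m" y] dist_triangle[of x y z] V assms(2) Z(7)
    by (simp add: dist_sym)
qed

text \<open>If some vertex of \<open>Y\<close> is farther from \<open>x\<close> than two of its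
  neighbours in \<open>Y\<close>, then \<open>peak\<close> gives all distances on \<open>Y\<close>,
  and the antipodal sums reverse the inequality. Only in a square can such a vertex be missing;
  there \<open>c 2\<close> is compared with \<open>c 1\<close>.\<close>

lemma opposite_edge_closer:
  assumes Y: "convex_even_cycle V E Y" and c: "cycle_enum E Y (2 * m) c" and x: "x \<in> V"
    and less: "d x (c 0) < d x (c 1)"
  shows "d x (c (m + 1)) < d x (c m)"
proof -
  have Yc: "convex_subgraph V E Y" using Y by (simp add: convex_even_cycle_def)
  have m: "2 \<le> m" using c by (simp add: cycle_enum_iff)
  have inY: "c i \<in> Y" if "i < 2 * m" for i using cycle_enum_mem[OF c that] .
  have peak_case: ?thesis
    if "{z, p, q} \<subseteq> Y" "{z, p} \<in> E" "{z, q} \<in> E" "p \<noteq> q" "d x p < d x z" "d x q < d x z" for z p q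
  proof -
    have *: "d x y + d z y = d x z" if "y \<in> Y" for y
      using peak[OF Y x \<open>{z, p, q} \<subseteq> Y\<close> \<open>{z, p} \<in> E\<close> \<open>{z, q} \<in> E\<close> \<open>p \<noteq> q\<close> \<open>d x p < d x z\<close>
          \<open>d x q < d x z\<close> that] .
    have "d z (c 0) + d z (c m) = m" "d z (c 1) + d z (c (m + 1)) = m"
      using dist_antipodes[OF Yc c, of 0 z] dist_antipodes[OF Yc c, of 1 z] m that
      by (auto simp: add.commute)
    moreover have "c 0 \<in> Y" "c 1 \<in> Y" "c m \<in> Y" "c (m + 1) \<in> Y"
      using m by (auto intro: inY)
    note this[THEN *]
    ultimately show ?thesis using less by linarith
  qed
  show ?thesis
  proof (cases "m = 2")
    case False
    have "finite Y" "Y \<noteq> {}"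
      using c inY[of 0] m by (auto simp: cycle_enum_iff bij_betw_def)
    define M where "M = Max (d x ` Y)"
    have "M \<in> d x ` Y" "\<And>y. y \<in> Y \<Longrightarrow> d x y \<le> M"
      using \<open>finite Y\<close> \<open>Y \<noteq> {}\<close> by (auto simp: M_def)
    then obtain z where z: "z \<in> Y" "\<And>y. y \<in> Y \<Longrightarrow> d x y \<le> d x z"
      by blast
    obtain c' where c': "cycle_enum E Y (2 * m) c'" "c' 0 = z"
      using cycle_enum_from_vertex[OF c z(1)] .
    have mem: "c' 1 \<in> Y" "c' (2 * m - 1) \<in> Y"
      using cycle_enum_mem[OF c'(1)] m by auto
    have e: "{z, c' 1} \<in> E" "{z, c' (2 * m - 1)} \<in> E"
      using cycle_enum_Suc_edge[OF c'(1), of 0] cycle_enum_last_edge[OF c'(1)] c' m by auto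
    \<comment> \<open>An equidistant neighbour of the farthest vertex \<open>z\<close> would place
      an edge of \<open>Y\<close> in a triangle and force a square.\<close>
    have "d x y < d x z" if "y \<in> Y" "{z, y} \<in> E" for y
    proof -
      have "d x z \<noteq> d x y"
        using triangle_cond[OF x that(2)] triangle_edge_in_square[OF Y c z(1) that] False by metis
      then show ?thesis using z(2)[OF that(1)] by simp
    qed
    moreover have "c' 1 \<noteq> c' (2 * m - 1)"
      using cycle_enum_eq_iff[OF c'(1), of 1 "2 * m - 1"] m by auto
    ultimately show ?thesis
      using peak_case[of z "c' 1" "c' (2 * m - 1)"] mem e z(1) by auto
  next
    case True
    have e: "{c 0, c 1} \<in> E" "{c 1, c 2} \<in> E" "{c 2, c 3} \<in> E" "{c 0, c 3} \<in> E"
      using cycle_enum_Suc_edge[OF c, of 0] cycle_enum_Suc_edge[OF c, of 1]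
        cycle_enum_Suc_edge[OF c, of 2] cycle_enum_last_edge[OF c] True
      by (auto simp: numeral_2_eq_2 numeral_3_eq_3)
    have mem: "c 0 \<in> Y" "c 1 \<in> Y" "c 2 \<in> Y" "c 3 \<in> Y" using inY True by auto
    then have V: "c 0 \<in> V" "c 1 \<in> V" "c 2 \<in> V" "c 3 \<in> V"
      using Yc by (auto simp: convex_subgraph_def)
    have d02: "d (c 0) (c 2) = 2" using dist_cycle_0[OF Yc c, of 2] True by simp
    have "d x (c 3) < d x (c 2)"
    proof (cases "d x (c 2)" "d x (c 1)" rule: linorder_cases)
      case less2: less
      have "c 0 \<noteq> c 2" using cycle_enum_eq_iff[OF c, of 0 2] True by simp
      then show ?thesis
        using peak_case[of "c 1" "c 0" "c 2"] e mem less less2 True by (simp add: insert_commute)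
    next
      case greater
      then show ?thesis
        using less dist_edge_bounds[OF e(4) x] dist_edge_bounds[OF e(3) x]
          dist_edge_bounds[OF e(2) x] by linarith
    next
      case equal
      then obtain z where z: "{c 1, z} \<in> E" "{c 2, z} \<in> E" "Suc (d x z) = d x (c 1)"
        using triangle_cond[OF x e(2)] by metis
      have zV: "z \<in> V" using edgeD[OF z(1)] by simp
      have "c 0 \<noteq> z" using d02 dist_edge_1[OF edge_sym[OF z(2)]] zV V by (auto simp: dist_sym)
      moreover have "Suc (d x (c 0)) = d x (c 1)"
        using less dist_edge_bounds[OF e(1) x] by linarith
      ultimately obtain Z n u where Z: "convex_even_cycle V E Z" "cycle_enum E Z (2 * n) u"
        "2 \<le> n" "u 0 = c 1" "u 1 = c 0" "u (2 * n - 1) = z" "d x (u n) + n = d x (c 1)"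
        using cycle_cond[OF x edge_sym[OF e(1)] z(1)] z(3) by metis
      \<comment> \<open>The edge \<open>{c 1, z}\<close> of \<open>Z\<close> lies in a triangle with
        \<open>c 2\<close>, so \<open>Z\<close> is a square; its vertex \<open>u 2\<close> is nearer
        to \<open>x\<close> than \<open>c 1\<close> by two.\<close>
      have "n = 2"
        using triangle_edge_in_square[OF Z(1,2), of "c 1" z "c 2"] cycle_enum_mem[OF Z(2), of 0]
          cycle_enum_mem[OF Z(2), of "2 * n - 1"] Z(3-6) z e(2) by (auto simp: insert_commute)
      have w: "{c 0, u 2} \<in> E" "{u 2, z} \<in> E"
        using cycle_enum_Suc_edge[OF Z(2), of 1] cycle_enum_Suc_edge[OF Z(2), of 2] Z \<open>n = 2\<close>
        by (auto simp: numeral_2_eq_2 numeral_3_eq_3)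
      have wV: "u 2 \<in> V" using edgeD[OF w(2)] by simp
      have "d (c 2) (u 2) \<le> 2"
        using dist_edge_bounds[OF w(2) V(3)] dist_edge_1[OF z(2)] by simp
      moreover have "d x (c 2) \<le> d x (u 2) + d (c 2) (u 2)"
        using dist_triangle[OF x wV V(3)] V wV by (simp add: dist_sym)
      ultimately have "d (c 2) (u 2) = 2"
        using Z(7) \<open>n = 2\<close> equal by simp
      \<comment> \<open>The edge \<open>{c 0, u 2}\<close> is equidistant from \<open>c 2\<close>.
        The new vertex \<open>t\<close> lies between \<open>c 0\<close> and \<open>c 2\<close>, so
        it is \<open>c 1\<close> or \<open>c 3\<close>; since \<open>c 1\<close> is opposite to
        \<open>u 2\<close> in \<open>Z\<close>, it is \<open>c 3\<close>, which is therefore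
        adjacent to \<open>u 2\<close>.\<close>
      then obtain t where t: "{c 0, t} \<in> E" "{u 2, t} \<in> E" "Suc (d (c 2) t) = 2"
        using triangle_cond[OF V(3) w(1)] d02 V by (metis dist_sym)
      have tV: "t \<in> V" using edgeD[OF t(1)] by simp
      have "t \<in> Y"
        using convex_subgraphD[OF Yc mem(1,3) tV] t(3) d02 dist_edge_1[OF t(1)] tV V
        by (simp add: dist_sym)
      then have "t = c 1 \<or> t = c 3"
        using cycle_enum_neighbours_0[OF c _ t(1)] True by simp
      moreover have "d (c 1) (u 2) = 2"
        using dist_cycle_0[OF _ Z(2), of 2] Z(1,4) \<open>n = 2\<close> by (simp add: convex_even_cycle_def)
      then have "t \<noteq> c 1"
        using dist_edge_1[OF edge_sym[OF t(2)]] by auto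
      ultimately have "{u 2, c 3} \<in> E" using t(2) by simp
      then show ?thesis
        using dist_edge_bounds(2)[OF _ x] Z(7) \<open>n = 2\<close> equal by fastforce
    qed
    then show ?thesis using True by (simp add: numeral_3_eq_3 numeral_2_eq_2)
  qed
qed

subsection \<open>Gates and hyperplanes\<close>

definition gate :: "'a set \<Rightarrow> 'a \<Rightarrow> 'a" where
  "gate C x = arg_min (d x) (\<lambda>a. a \<in> C)"

lemma maximal_cliqueD:
  assumes "maximal_clique V E C"
  shows "C \<subseteq> V" "\<And>x y. x \<in> C \<Longrightarrow> y \<in> C \<Longrightarrow> x \<noteq> y \<Longrightarrow> {x, y} \<in> E" "C \<noteq> {}"
proof -
  show *: "C \<subseteq> V" "\<And>x y. x \<in> C \<Longrightarrow> y \<in> C \<Longrightarrow> x \<noteq> y \<Longrightarrow> {x, y} \<in> E"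
    using assms by (auto simp: maximal_clique_def complete_subgraph_def)
  obtain v where "v \<in> V" using connected by (auto simp: connected_graph_def)
  then have "complete_subgraph V E {v}" by (simp add: complete_subgraph_def)
  then show "C \<noteq> {}"
    using assms unfolding maximal_clique_def by blast
qed

text \<open>The common closed neighbourhood of \<open>a\<close> and \<open>b\<close> works: two
  non-adjacent members would form a K4 minus an edge with \<open>a\<close> and \<open>b\<close>, and
  every complete subgraph containing \<open>a\<close> and \<open>b\<close> lies inside it.\<close>

lemma maximal_clique_of_edge:
  assumes "{a, b} \<in> E"
  obtains C where "maximal_clique V E C" "a \<in> C" "b \<in> C"
proof -
  define C where "C = {v \<in> V. (v = a \<or> {v, a} \<in> E) \<and> (v = b \<or> {v, b} \<in> E)}"
  have ab: "a \<in> C" "b \<in> C" using assms edgeD[OF assms] by (auto simp: C_def insert_commute)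
  have "{u, v} \<in> E" if "u \<in> C" "v \<in> C" "u \<noteq> v" for u v
    using that assms no_K4_minus[of u v a b] by (auto simp: C_def insert_commute)
  moreover have "C \<subseteq> V" by (auto simp: C_def)
  ultimately have "complete_subgraph V E C" unfolding complete_subgraph_def by metis
  moreover have "D = C" if D: "complete_subgraph V E D" "C \<subseteq> D" for D
  proof
    have abD: "a \<in> D" "b \<in> D" using ab D(2) by blast+
    show "D \<subseteq> C"
    proof
      fix v assume "v \<in> D"
      then show "v \<in> C"
        using D(1) abD unfolding complete_subgraph_def C_def by blast
    qed
  qed (fact D(2))
  ultimately have "maximal_clique V E C" unfolding maximal_clique_def by blast
  then show ?thesis using that ab by blast
qed

section \<open>Gates on a fixed maximal clique\<close>

context
  fixes C assumes C: "maximal_clique V E C"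
begin

lemma gate_in: "gate C x \<in> C"
  using maximal_cliqueD(3)[OF C] arg_min_nat_lemma[of "\<lambda>a. a \<in> C" _ "d x"]
  unfolding gate_def by blast

lemma gate_in_V: "gate C x \<in> V"
  using gate_in maximal_cliqueD(1)[OF C] by blast

lemma gate_le: "a \<in> C \<Longrightarrow> d x (gate C x) \<le> d x a"
  using arg_min_nat_lemma[of "\<lambda>a. a \<in> C" _ "d x"] unfolding gate_def by blast

text \<open>If \<open>b\<close> were as near as the gate, the triangle condition would give a nearer
  common neighbour \<open>z\<close>, necessarily outside \<open>C\<close>. Absence of a K4 minus an
  edge makes \<open>z\<close> adjacent to all of \<open>C\<close>, contradicting maximality.\<close>

lemma dist_gate:
  assumes "x \<in> V" "b \<in> C" "b \<noteq> gate C x"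
  shows "d x b = Suc (d x (gate C x))"
proof -
  let ?a = "gate C x"
  have ab: "{?a, b} \<in> E" using maximal_cliqueD(2)[OF C gate_in assms(2)] assms(3) by metis
  have "d x ?a \<noteq> d x b"
  proof
    assume "d x ?a = d x b"
    then obtain z where z: "{?a, z} \<in> E" "{b, z} \<in> E" "Suc (d x z) = d x ?a"
      using triangle_cond[OF assms(1) ab] by blast
    have "z \<notin> C" using gate_le[of z x] z(3) by auto
    have "{c, z} \<in> E" if "c \<in> C" for c
    proof (cases "c = ?a \<or> c = b")
      case False
      then have "{c, ?a} \<in> E" "{c, b} \<in> E" "c \<noteq> z"
        using maximal_cliqueD(2)[OF C that] gate_in assms(2) \<open>z \<notin> C\<close> that by blast+
      then show ?thesis
        using no_K4_minus[of c z ?a b] z ab by (auto simp: insert_commute)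
    qed (use z in auto)
    then have "complete_subgraph V E (insert z C)"
      using C edgeD[OF z(1)]
      by (auto simp: complete_subgraph_def maximal_clique_def insert_commute)
    then have "insert z C = C"
      using C unfolding maximal_clique_def by blast
    then show False using \<open>z \<notin> C\<close> by blast
  qed
  then show ?thesis
    using gate_le[OF assms(2), of x] dist_edge_bounds[OF ab assms(1)] by linarith
qed

text \<open>By \<open>dist_gate\<close> the vertices of \<open>C\<close> other than the gate are all
  equally far, so one strict comparison identifies the gate.\<close>

lemma gate_eqI: "x \<in> V \<Longrightarrow> a \<in> C \<Longrightarrow> b \<in> C \<Longrightarrow> d x a < d x b \<Longrightarrow> gate C x = a"
  using dist_gate[of x a] dist_gate[of x b] gate_le[of a x] by (cases "b = gate C x") force+

lemma gate_of_member:
  assumes "a \<in> C"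
  shows "gate C a = a"
proof (rule ccontr)
  assume "gate C a \<noteq> a"
  then show False
    using dist_gate[of a a] maximal_cliqueD(1)[OF C] assms by auto
qed

text \<open>Each end is one step farther from the other end's gate than from its own. Crossing the
  edge gains at most one, so the two distances bound each other.\<close>

lemma dist_gates:
  assumes "{x, y} \<in> E" "gate C x \<noteq> gate C y"
  shows "d x (gate C x) = d y (gate C y)"
proof -
  have V: "x \<in> V" "y \<in> V" using edgeD[OF assms(1)] by auto
  have "d x (gate C y) = Suc (d x (gate C x))"
    using dist_gate[OF V(1) gate_in] assms(2) by metis
  moreover have "d y (gate C x) = Suc (d y (gate C y))"
    using dist_gate[OF V(2) gate_in assms(2)] .
  ultimately show ?thesis
    using dist_edge_le[OF assms(1) gate_in_V[of y]] dist_edge_le[OF edge_sym[OF assms(1)] gate_in_V[of x]]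
    by linarith
qed

text \<open>If \<open>z\<close> shared the gate of \<open>x\<close>, both would be equally far from
  that gate while \<open>y\<close> is one farther, against \<open>triangle_dist\<close>.\<close>

lemma gate_triangle:
  assumes "{x, y} \<in> E" "{x, z} \<in> E" "{y, z} \<in> E" "gate C x \<noteq> gate C y"
  shows "gate C z \<noteq> gate C x"
proof
  assume z: "gate C z = gate C x"
  let ?a = "gate C x"
  have V: "x \<in> V" "y \<in> V" "z \<in> V" "?a \<in> V"
    using edgeD[OF assms(3)] edgeD[OF assms(1)] gate_in_V by simp_all
  have y: "d y ?a = Suc (d x ?a)"
    using dist_gate[OF V(2) gate_in assms(4)] dist_gates[OF assms(1,4)] by simp
  have "d z ?a = d y (gate C y)"
    using dist_gates[OF assms(3)] z assms(4) by metis
  then have "d z ?a = d x ?a" using dist_gates[OF assms(1,4)] by simp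
  then show False
    using triangle_dist[OF V(4) assms(2,1)] assms(3) y V by (simp add: dist_sym insert_commute)
qed

text \<open>\<open>opposite_edge_closer\<close> is applied from both gates, with the cycle reversed
  for the second. The gates are adjacent, so their distances to any vertex differ by at most one,
  and the two strict inequalities decide which is nearer at each end of the opposite edge.\<close>

lemma gate_opposite:
  assumes Y: "convex_even_cycle V E Y" and c: "cycle_enum E Y (2 * m) c"
    and "gate C (c 0) \<noteq> gate C (c 1)"
  shows "gate C (c (m + 1)) = gate C (c 0)" "gate C (c m) = gate C (c 1)"
proof -
  let ?a = "gate C (c 0)" and ?b = "gate C (c 1)"
  have m: "2 \<le> m" using c by (simp add: cycle_enum_iff)
  have Yc: "convex_subgraph V E Y" using Y by (simp add: convex_even_cycle_def)
  have V: "c 0 \<in> V" "c 1 \<in> V" "c m \<in> V" "c (m + 1) \<in> V" "?a \<in> V" "?b \<in> V"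
    using convex_cycle_subset[OF Yc c] m gate_in_V by auto
  have e: "{c 0, c 1} \<in> E" "{c m, c (m + 1)} \<in> E"
    using cycle_enum_Suc_edge[OF c, of 0] cycle_enum_Suc_edge[OF c, of m] m by auto
  have "d (c 0) ?a = d (c 1) ?b" "d (c 0) ?b = Suc (d (c 0) ?a)" "d (c 1) ?a = Suc (d (c 1) ?b)"
    using dist_gates[OF e(1) assms(3)] dist_gate[OF V(1) gate_in assms(3)[symmetric]]
      dist_gate[OF V(2) gate_in assms(3)] by simp_all
  then have "d ?a (c 0) < d ?a (c 1)" "d ?b (c 1) < d ?b (c 0)"
    using V by (simp_all add: dist_sym)
  moreover obtain c' where "cycle_enum E Y (2 * m) c'" "c' 0 = c 1" "c' 1 = c 0"
    "c' m = c (m + 1)" "c' (m + 1) = c m"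
    using cycle_enum_antipodal_edges(2)[OF c] by blast
  ultimately have "d ?a (c (m + 1)) < d ?a (c m)" "d ?b (c m) < d ?b (c (m + 1))"
    using opposite_edge_closer[OF Y c V(5)] opposite_edge_closer[OF Y _ V(6), of m c'] by simp_all
  moreover have "d ?a z \<le> Suc (d ?b z)" "d ?b z \<le> Suc (d ?a z)" if "z \<in> V" for z
    using dist_edge_le[of ?a ?b z] dist_edge_le[of ?b ?a z] that assms(3)
      maximal_cliqueD(2)[OF C gate_in gate_in] by metis+
  note this[OF V(3)] this[OF V(4)]
  moreover note dist_edge_bounds[OF e(2) V(5)] dist_edge_bounds[OF e(2) V(6)]
  ultimately have "d ?a (c (m + 1)) < d ?b (c (m + 1))" "d ?b (c m) < d ?a (c m)"
    by linarith+
  then have "d (c (m + 1)) ?a < d (c (m + 1)) ?b" "d (c m) ?b < d (c m) ?a"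
    using V by (simp_all add: dist_sym)
  then show "gate C (c (m + 1)) = ?a" "gate C (c m) = ?b"
    using gate_eqI V gate_in by metis+
qed

lemma gate_edge_rel:
  assumes "(e, e') \<in> edge_rel V E" "e = {x, y}" "gate C x \<noteq> gate C y"
  obtains x' y' where "e' = {x', y'}" "gate C x' \<noteq> gate C y'"
proof -
  have E: "e \<in> E" "e' \<in> E" using assms(1) by (auto simp: edge_rel_def)
  consider Y c where "cycle_enum E Y 3 c" "e \<subseteq> Y" "e' \<subseteq> Y"
    | Y where "convex_even_cycle V E Y" "opposite_edges E Y e e'"
    using assms(1) by (auto simp: edge_rel_def)
  then show ?thesis
  proof cases
    case 1
    obtain u v where uv: "e' = {u, v}" "u \<noteq> v" using edgeE[OF E(2)] by metis
    have in_Y: "x \<in> Y" "y \<in> Y" "u \<in> Y" "v \<in> Y" using 1 uv assms(2) by auto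
    have "x \<noteq> y" using assms(3) by auto
    have Yedge: "{p, q} \<in> E" if "p \<in> Y" "q \<in> Y" "p \<noteq> q" for p q
      using cycle_enum_3_edge[OF 1(1) that] .
    have third: "gate C p \<noteq> gate C x" "gate C p \<noteq> gate C y" if "p \<in> Y" "p \<noteq> x" "p \<noteq> y" for p
      using gate_triangle[of x y p] gate_triangle[of y x p] Yedge in_Y that \<open>x \<noteq> y\<close> assms(3)
      by metis+
    have "u \<in> {x, y} \<or> v \<in> {x, y}"
    proof (rule ccontr)
      assume "\<not> ?thesis"
      then have "card {x, y, u, v} = 4" using uv(2) \<open>x \<noteq> y\<close> by auto
      moreover have "card {x, y, u, v} \<le> card Y"
        using in_Y 1(1) by (intro card_mono) (auto simp: cycle_enum_iff bij_betw_def)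
      ultimately show False using cycle_enum_card[OF 1(1)] by simp
    qed
    then have "gate C u \<noteq> gate C v"
      using third[of u] third[of v] in_Y uv(2) assms(3) by (cases "u = x"; cases "u = y"; cases "v = x"; cases "v = y") auto
    then show ?thesis using that uv by blast
  next
    case 2
    then obtain m c where c: "cycle_enum E Y (2 * m) c" "e = {c 0, c 1}" "e' = {c m, c (m + 1)}"
      by (auto simp: opposite_edges_iff)
    then have "gate C (c 0) \<noteq> gate C (c 1)"
      using assms(2,3) by (auto simp: doubleton_eq_iff)
    then show ?thesis
      using gate_opposite[OF 2(1) c(1)] that[OF c(3)] by metis
  qed
qed

text \<open>Induction on the distance to the gate: an edge with distinct gates is opposite, in a
  convex even cycle, to an edge with the same gates that is nearer to \<open>C\<close>.\<close>

lemma gates_edge_related: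
  assumes "{x, y} \<in> E" "gate C x \<noteq> gate C y"
  shows "({gate C x, gate C y}, {x, y}) \<in> (edge_rel V E)\<^sup>*"
  using assms
proof (induction "d x (gate C x)" arbitrary: x y rule: less_induct)
  case less
  let ?a = "gate C x" and ?b = "gate C y"
  have V: "x \<in> V" "y \<in> V" "?a \<in> V" "?b \<in> V"
    using edgeD[OF less.prems(1)] gate_in_V by auto
  have D: "d y ?b = d x ?a" "d x ?b = Suc (d x ?a)" "d y ?a = Suc (d x ?a)"
    using dist_gates[OF less.prems] dist_gate[OF V(1) gate_in less.prems(2)[symmetric]]
      dist_gate[OF V(2) gate_in less.prems(2)] by simp_all
  show ?case
  proof (cases "d x ?a")
    case 0
    then have "x = ?a" "y = ?b"
      using D(1) dist_eq_0[OF V(1,3)] dist_eq_0[OF V(2,4)] by simp_all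
    then show ?thesis by (metis rtrancl.rtrancl_refl)
  next
    case (Suc k)
    then obtain y' where y': "{y, y'} \<in> E" "d y' ?b = k"
      using dist_Suc[OF V(2,4)] D(1) by metis
    have y'V: "y' \<in> V" using edgeD[OF y'(1)] by simp
    have ab: "{?b, ?a} \<in> E"
      using maximal_cliqueD(2)[OF C gate_in gate_in] less.prems(2) by metis
    \<comment> \<open>Seen from \<open>?a\<close>, both \<open>x\<close> and \<open>y'\<close> are
      one step nearer than \<open>y\<close>, as the cycle condition at \<open>y\<close>
      requires.\<close>
    have "d y' ?a = Suc k"
      using dist_edge_bounds(2)[OF ab y'V] dist_edge_le[OF y'(1) V(3)] D(3) Suc y'(2) by simp
    moreover have "x \<noteq> y'" using D(2) y'(2) Suc by auto
    ultimately obtain Y m c where Y: "convex_even_cycle V E Y" "cycle_enum E Y (2 * m) c" "2 \<le> m"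
      "c 0 = y" "c 1 = x" "c (2 * m - 1) = y'" "d ?a (c m) + m = d ?a y"
      using cycle_cond[OF V(3) edge_sym[OF less.prems(1)] y'(1)] D(3) Suc V y'V
      by (metis dist_sym)
    have gates: "gate C (c (m + 1)) = ?b" "gate C (c m) = ?a"
      using gate_opposite[OF Y(1,2)] Y(4,5) less.prems(2) by auto
    have e: "{c m, c (m + 1)} \<in> E"
      using cycle_enum_Suc_edge[OF Y(2), of m] Y(3) by simp
    have "d (c m) ?a < d x ?a"
      using Y(3,7) D(3) V edgeD[OF e] by (simp add: dist_sym)
    then have "({?a, ?b}, {c m, c (m + 1)}) \<in> (edge_rel V E)\<^sup>*"
      using less.hyps[of "c m" "c (m + 1)"] e gates less.prems(2) by simp
    moreover have "opposite_edges E Y {c 0, c 1} {c m, c (m + 1)}"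
      unfolding opposite_edges_iff using Y(2) by blast
    then have "opposite_edges E Y {c m, c (m + 1)} {x, y}"
      using opposite_edges_sym Y(4,5) by (metis insert_commute)
    then have "({c m, c (m + 1)}, {x, y}) \<in> edge_rel V E"
      using Y(1) e less.prems(1) unfolding edge_rel_def by blast
    ultimately show ?thesis by (rule rtrancl_into_rtrancl)
  qed
qed

section \<open>Hyperplanes and sectors described by gates\<close>

lemma clique_edges_related:
  assumes "a \<in> C" "b \<in> C" "c \<in> C" "a \<noteq> b" "a \<noteq> c"
  shows "({a, b}, {a, c}) \<in> (edge_rel V E)\<^sup>*"
proof (cases "b = c")
  case False
  have e: "{a, b} \<in> E" "{a, c} \<in> E" "{b, c} \<in> E"
    using maximal_cliqueD(2)[OF C] assms False by simp_all
  have "{u} \<notin> E" for u using edgeD(3)[of u u] by auto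
  then obtain f where "cycle_enum E {a, b, c} 3 f"
    using cycle_enum_triangle[OF e] by blast
  moreover have "{a, b, c} \<subseteq> V" "{a, b} \<subseteq> {a, b, c}" "{a, c} \<subseteq> {a, b, c}"
    using maximal_cliqueD(1)[OF C] assms by auto
  ultimately have "({a, b}, {a, c}) \<in> edge_rel V E"
    using e(1,2) unfolding edge_rel_def by blast
  then show ?thesis by blast
qed simp

text \<open>Forwards, distinctness of gates spreads from \<open>{a, b}\<close> along the relation by
  \<open>gate_edge_rel\<close>. Backwards, \<open>{a, b}\<close> is related inside \<open>C\<close>
  to the edge joining the two gates, and that edge to \<open>{x, y}\<close>.\<close>

lemma hyperplane_iff_gates:
  assumes J: "J \<in> hyperplanes V E" and ab: "a \<in> C" "b \<in> C" "{a, b} \<in> J" and xy: "{x, y} \<in> E"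
  shows "{x, y} \<in> J \<longleftrightarrow> gate C x \<noteq> gate C y"
proof -
  have "a \<noteq> b" using edgeD(3) hyperplane_subset[OF J] ab(3) by blast
  have J': "J = (edge_rel V E)\<^sup>* `` {{a, b}}"
    using hyperplane_eq[OF J ab(3)] by (simp add: hyperplane_of_def)
  show ?thesis
  proof
    assume "{x, y} \<in> J"
    then have "({a, b}, {x, y}) \<in> (edge_rel V E)\<^sup>*" using J' by simp
    then have "\<exists>u v. {x, y} = {u, v} \<and> gate C u \<noteq> gate C v"
    proof (induction rule: rtrancl_induct)
      case base
      then show ?case using gate_of_member ab \<open>a \<noteq> b\<close> by metis
    next
      case (step e e')
      then show ?case using gate_edge_rel by metis
    qed
    then show "gate C x \<noteq> gate C y" by (auto simp: doubleton_eq_iff)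
  next
    assume neq: "gate C x \<noteq> gate C y"
    let ?a = "gate C x" and ?b = "gate C y"
    \<comment> \<open>Edges of \<open>C\<close> sharing a vertex are related; if \<open>?a\<close>
      is not \<open>a\<close>, the edge \<open>{a, ?a}\<close> serves as a pivot.\<close>
    have "({a, b}, {?a, ?b}) \<in> (edge_rel V E)\<^sup>*"
    proof (cases "?a = a")
      case True
      then show ?thesis
        using clique_edges_related[of a b ?b] ab gate_in \<open>a \<noteq> b\<close> neq by metis
    next
      case False
      have "({a, b}, {a, ?a}) \<in> (edge_rel V E)\<^sup>*"
        using clique_edges_related[of a b ?a] ab gate_in \<open>a \<noteq> b\<close> False by metis
      moreover have "({?a, a}, {?a, ?b}) \<in> (edge_rel V E)\<^sup>*"
        using clique_edges_related[of ?a a ?b] ab gate_in False neq by metis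
      ultimately show ?thesis by (simp add: insert_commute)
    qed
    also have "({?a, ?b}, {x, y}) \<in> (edge_rel V E)\<^sup>*"
      using gates_edge_related[OF xy neq] .
    finally show "{x, y} \<in> J" by (simp add: J')
  qed
qed

text \<open>Edges outside \<open>J\<close> preserve the gate. Conversely, a geodesic from a vertex
  to its gate never changes gate, hence avoids \<open>J\<close>, so vertices with a common gate are
  joined through it.\<close>

lemma sector_path_iff:
  assumes J: "J \<in> hyperplanes V E" and ab: "a \<in> C" "b \<in> C" "{a, b} \<in> J"
  shows "(\<exists>p. joins V (E - J) p x y) \<longleftrightarrow> x \<in> V \<and> y \<in> V \<and> gate C x = gate C y"
proof -
  note J_iff = hyperplane_iff_gates[OF J ab]
  have "a \<noteq> b" using edgeD(3) hyperplane_subset[OF J] ab(3) by blast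
  have to_gate: "\<exists>p. joins V (E - J) p u (gate C u)" if "u \<in> V" for u
    using that
  proof (induction "d u (gate C u)" arbitrary: u)
    case 0
    then have "u = gate C u" using dist_eq_0 gate_in_V by metis
    then have "joins V (E - J) [u] u (gate C u)" using 0 by (simp add: joins_def graph_path_def)
    then show ?case by blast
  next
    case (Suc n)
    obtain v where v: "{u, v} \<in> E" "d v (gate C u) = n"
      using dist_Suc[OF Suc.prems gate_in_V] Suc.hyps(2) by metis
    \<comment> \<open>A second vertex of \<open>C\<close> supplies the strict comparison by which
      \<open>gate_eqI\<close> shows that \<open>v\<close> keeps the gate of
      \<open>u\<close>.\<close>
    obtain c where c: "c \<in> C" "c \<noteq> gate C u" using ab \<open>a \<noteq> b\<close> by metis
    have cV: "c \<in> V" using maximal_cliqueD(1)[OF C] c by blast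
    have "d u c = Suc (Suc n)" using dist_gate[OF Suc.prems c] Suc.hyps(2) by simp
    then have "n < d v c" using dist_edge_le[OF v(1) cV] by simp
    then have g: "gate C v = gate C u"
      using gate_eqI[OF _ gate_in c(1)] edgeD[OF v(1)] v(2) by metis
    then obtain p where "joins V (E - J) p v (gate C u)"
      using Suc.hyps(1)[of v] v edgeD[OF v(1)] by metis
    moreover have "{u, v} \<in> E - J" using J_iff[OF v(1)] v(1) g by simp
    ultimately show ?case using joins_Cons Suc.prems by metis
  qed
  show ?thesis
  proof
    assume "\<exists>p. joins V (E - J) p x y"
    then obtain p where p: "joins V (E - J) p x y" by blast
    have "x \<in> V" "y \<in> V"
      using p by (auto simp: joins_def graph_path_def dest: subsetD[OF _ last_in_set] subsetD[OF _ hd_in_set])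
    moreover have "gate C x = gate C y"
      using p by (rule joins_invariant) (use J_iff in blast)
    ultimately show "x \<in> V \<and> y \<in> V \<and> gate C x = gate C y" by simp
  next
    assume "x \<in> V \<and> y \<in> V \<and> gate C x = gate C y"
    then show "\<exists>p. joins V (E - J) p x y"
      using to_gate[of x] to_gate[of y] joins_rev joins_trans by metis
  qed
qed

lemma sectors_eq_gate_fibres:
  assumes "J \<in> hyperplanes V E" "a \<in> C" "b \<in> C" "{a, b} \<in> J"
  shows "sectors V E J = (\<lambda>c. {x \<in> V. gate C x = c}) ` C"
proof -
  have "{(x, y). \<exists>p. joins V (E - J) p x y} = {(x, y). x \<in> V \<and> y \<in> V \<and> gate C x = gate C y}"
    using sector_path_iff[OF assms] by blast
  then have "sectors V E J = (\<lambda>v. {y \<in> V. gate C v = gate C y}) ` V"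
    unfolding sectors_def components_def quotient_def by auto
  also have "\<dots> = (\<lambda>c. {x \<in> V. gate C x = c}) ` C"
  proof (intro equalityI subsetI)
    fix S assume "S \<in> (\<lambda>c. {x \<in> V. gate C x = c}) ` C"
    then obtain c where "c \<in> C" "S = {x \<in> V. gate C x = c}" by blast
    then show "S \<in> (\<lambda>v. {y \<in> V. gate C v = gate C y}) ` V"
      using maximal_cliqueD(1)[OF C] gate_of_member by (intro image_eqI[of _ _ c]) auto
  next
    fix S assume "S \<in> (\<lambda>v. {y \<in> V. gate C v = gate C y}) ` V"
    then show "S \<in> (\<lambda>c. {x \<in> V. gate C x = c}) ` C"
      using gate_in by (auto simp: eq_commute)
  qed
  finally show ?thesis .
qed

lemma separated_iff_gates:
  assumes "J \<in> hyperplanes V E" "a \<in> C" "b \<in> C" "{a, b} \<in> J"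
  shows "separated_by V E J x y \<longleftrightarrow> x \<in> V \<and> y \<in> V \<and> gate C x \<noteq> gate C y"
proof
  show "separated_by V E J x y \<Longrightarrow> x \<in> V \<and> y \<in> V \<and> gate C x \<noteq> gate C y"
    unfolding separated_by_def sectors_eq_gate_fibres[OF assms] by auto
next
  assume xy: "x \<in> V \<and> y \<in> V \<and> gate C x \<noteq> gate C y"
  let ?S = "\<lambda>v. {u \<in> V. gate C u = gate C v}"
  have S: "?S v \<in> sectors V E J" for v
    unfolding sectors_eq_gate_fibres[OF assms] using gate_in by blast
  have "?S x \<noteq> ?S y \<and> x \<in> ?S x \<and> y \<in> ?S y" using xy by auto
  then show "separated_by V E J x y" unfolding separated_by_def by (intro bexI[OF _ S])
qed

end

text \<open>Brings an arbitrary hyperplane within reach of the gate lemmas.\<close>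

lemma hyperplane_cliqueE:
  assumes "J \<in> hyperplanes V E"
  obtains C a b where "maximal_clique V E C" "a \<in> C" "b \<in> C" "{a, b} \<in> J"
proof -
  obtain e where e: "e \<in> J" "e \<in> E"
    using hyperplane_nonempty[OF assms] hyperplane_subset[OF assms] by blast
  obtain a b where ab: "e = {a, b}" using edgeE[OF e(2)] by metis
  then obtain C where "maximal_clique V E C" "a \<in> C" "b \<in> C"
    using maximal_clique_of_edge e(2) by metis
  then show ?thesis using that e(1) ab by blast
qed

subsection \<open>Crossings\<close>

text \<open>On a clique through the crossed edge, every later vertex of the path is nearer to
  \<open>p ! Suc i\<close> than to \<open>p ! i\<close>, so the gate stays
  \<open>p ! Suc i\<close>.\<close>

lemma geodesic_crosses_once:
  assumes p: "geodesic V E p" and J: "J \<in> hyperplanes V E"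
    and ij: "i < j" "Suc j < length p" "{p ! i, p ! Suc i} \<in> J"
  shows "{p ! j, p ! Suc j} \<notin> J"
proof -
  have path: "graph_path V E p" using p by (simp add: geodesic_def)
  have e: "{p ! i, p ! Suc i} \<in> E" using path_edge[OF path, of i] ij by simp
  then obtain C where C: "maximal_clique V E C" "p ! i \<in> C" "p ! Suc i \<in> C"
    by (rule maximal_clique_of_edge)
  have "gate C (p ! k) = p ! Suc i" if "i < k" "k < length p" for k
  proof (rule gate_eqI[OF C(1) _ C(3,2)])
    show V: "p ! k \<in> V" using path_in_V[OF path that(2)] .
    show "d (p ! k) (p ! Suc i) < d (p ! k) (p ! i)"
      using geodesic_dist[OF p, of "Suc i" k] geodesic_dist[OF p, of i k] that V
        edgeD[OF e] by (simp add: dist_sym)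
  qed
  then show ?thesis
    using hyperplane_iff_gates[OF C(1) J C(2,3) ij(3) path_edge[OF path ij(2)]] ij by simp
qed

text \<open>The gate changes exactly at the edges of the path lying in the hyperplane. No change
  leaves the ends together, and a single change cannot be undone, so the edges of the path enumerate
  the separating hyperplanes without repetition.\<close>

lemma separating_hyperplanes_of_path:
  assumes p: "graph_path V E p" and once: "\<forall>J\<in>hyperplanes V E. crossings p J \<le> 1"
  defines "H \<equiv> \<lambda>i. hyperplane_of V E {p ! i, p ! Suc i}"
  shows "{J \<in> hyperplanes V E. separated_by V E J (hd p) (last p)} = H ` {..<length p - 1}"
    and "inj_on H {..<length p - 1}"
proof -
  let ?n = "length p - 1"
  have ne: "p \<noteq> []" using p by (simp add: graph_path_def)
  have ends: "hd p = p ! 0" "last p = p ! ?n" using ne by (simp_all add: hd_conv_nth last_conv_nth)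
  have V: "p ! i \<in> V" if "i \<le> ?n" for i
    using path_in_V[OF p, of i] that ne by (cases p) auto
  have e: "{p ! i, p ! Suc i} \<in> E" if "i < ?n" for i
    using path_edge[OF p, of i] that by simp
  have H: "H i \<in> hyperplanes V E" "{p ! i, p ! Suc i} \<in> H i" if "i < ?n" for i
    using e[OF that] by (simp_all add: H_def hyperplane_of_in mem_hyperplane_of)
  have unique: "i = j" if "J \<in> hyperplanes V E" "i < ?n" "j < ?n" "{p ! i, p ! Suc i} \<in> J"
    "{p ! j, p ! Suc j} \<in> J" for i j J
  proof -
    have "crossings p J \<le> 1" using once that(1) by blast
    moreover have "Suc i < length p" "Suc j < length p" using that(2,3) by auto
    ultimately show ?thesis
      unfolding crossings_le_1_iff using that(4,5) by (cases i j rule: linorder_cases) auto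
  qed
  show "inj_on H {..<?n}"
  proof (rule inj_onI)
    fix i j assume "i \<in> {..<?n}" "j \<in> {..<?n}" "H i = H j"
    then show "i = j" using unique[of "H i" i j] H[of i] H[of j] by simp
  qed
  have const: "g (p ! i) = g (p ! j)"
    if "i \<le> j" "\<And>k. i \<le> k \<Longrightarrow> k < j \<Longrightarrow> g (p ! k) = g (p ! Suc k)" for i j and g :: "'a \<Rightarrow> 'a"
    using that by (induction j rule: dec_induct) auto
  show "{J \<in> hyperplanes V E. separated_by V E J (hd p) (last p)} = H ` {..<?n}"
  proof (intro equalityI subsetI)
    fix J assume "J \<in> {J \<in> hyperplanes V E. separated_by V E J (hd p) (last p)}"
    then have J: "J \<in> hyperplanes V E" "separated_by V E J (p ! 0) (p ! ?n)" by (auto simp: ends)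
    obtain C a b where C: "maximal_clique V E C" "a \<in> C" "b \<in> C" "{a, b} \<in> J"
      using hyperplane_cliqueE[OF J(1)] .
    have "gate C (p ! 0) \<noteq> gate C (p ! ?n)"
      using separated_iff_gates[OF C(1) J(1) C(2-4)] J(2) by simp
    then obtain k where k: "k < ?n" "gate C (p ! k) \<noteq> gate C (p ! Suc k)"
      using const[of 0 ?n "gate C"] by auto
    then have "{p ! k, p ! Suc k} \<in> J"
      using hyperplane_iff_gates[OF C(1) J(1) C(2-4) e] by simp
    then have "J = H k" using hyperplane_eq[OF J(1)] by (simp add: H_def)
    then show "J \<in> H ` {..<?n}" using k by simp
  next
    fix J assume "J \<in> H ` {..<?n}"
    then obtain i where i: "i < ?n" "J = H i" by auto
    note Hi = H[OF i(1)]
    obtain C where C: "maximal_clique V E C" "p ! i \<in> C" "p ! Suc i \<in> C"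
      using maximal_clique_of_edge[OF e[OF i(1)]] .
    note crosses = hyperplane_iff_gates[OF C(1) Hi(1) C(2,3) Hi(2) e]
    have same: "gate C (p ! k) = gate C (p ! Suc k)" if "k < ?n" "k \<noteq> i" for k
      using crosses[OF that(1)] unique[OF Hi(1) i(1) that(1) Hi(2)] that(2) by blast
    \<comment> \<open>The gate is constant before and after the only crossing.\<close>
    have "gate C (p ! 0) = gate C (p ! i)" "gate C (p ! Suc i) = gate C (p ! ?n)"
      using i(1) by (auto intro!: const same)
    then have "gate C (p ! 0) \<noteq> gate C (p ! ?n)" using crosses[OF i(1)] Hi(2) by simp
    then have "separated_by V E J (hd p) (last p)"
      using separated_iff_gates[OF C(1) Hi(1) C(2,3) Hi(2)] V i(2) ends by simp
    then show "J \<in> {J \<in> hyperplanes V E. separated_by V E J (hd p) (last p)}"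
      using Hi(1) i(2) by simp
  qed
qed

section \<open>Distance and convexity by counting separating hyperplanes\<close>

lemma card_separating_of_path:
  assumes "graph_path V E p" "\<forall>J\<in>hyperplanes V E. crossings p J \<le> 1"
  shows "finite {J \<in> hyperplanes V E. separated_by V E J (hd p) (last p)}"
    and "length p = Suc (card {J \<in> hyperplanes V E. separated_by V E J (hd p) (last p)})"
proof -
  note s = separating_hyperplanes_of_path[OF assms]
  show "finite {J \<in> hyperplanes V E. separated_by V E J (hd p) (last p)}"
    unfolding s(1) by simp
  have "p \<noteq> []" using assms(1) by (simp add: graph_path_def)
  then show "length p = Suc (card {J \<in> hyperplanes V E. separated_by V E J (hd p) (last p)})"
    unfolding s(1) card_image[OF s(2)] by (cases p) auto
qed

lemma geodesic_crossings:
  assumes "geodesic V E p" "J \<in> hyperplanes V E"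
  shows "crossings p J \<le> 1"
  unfolding crossings_le_1_iff using geodesic_crosses_once[OF assms] by blast

text \<open>A shortest path supplies the count. Finiteness is recorded because \<open>card\<close>
  is 0 on infinite sets and the counting in \<open>sector_convex\<close> relies on it.\<close>

lemma dist_eq_card_separating:
  assumes "x \<in> V" "y \<in> V"
  shows "finite {J \<in> hyperplanes V E. separated_by V E J x y}"
    and "d x y = card {J \<in> hyperplanes V E. separated_by V E J x y}"
proof -
  obtain p where p: "joins V E p x y" "length p = Suc (d x y)"
    using shortest_path[OF assms] .
  then have g: "geodesic V E p" and path: "graph_path V E p" and ends: "hd p = x" "last p = y"
    by (auto simp: geodesic_def joins_def)
  note s = card_separating_of_path[OF path, unfolded ends]
  show "finite {J \<in> hyperplanes V E. separated_by V E J x y}"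
    using s geodesic_crossings[OF g] by blast
  show "d x y = card {J \<in> hyperplanes V E. separated_by V E J x y}"
    using s(2) geodesic_crossings[OF g] p(2) by simp
qed

lemma sector_convex:
  assumes J: "J \<in> hyperplanes V E" and S: "S \<in> sectors V E J"
  shows "convex_subgraph V E S"
proof -
  obtain C a b where C: "maximal_clique V E C" "a \<in> C" "b \<in> C" "{a, b} \<in> J"
    using hyperplane_cliqueE[OF J] .
  note sep_iff = separated_iff_gates[OF C(1) J C(2-4)]
  obtain c where c: "S = {x \<in> V. gate C x = c}"
    using S sectors_eq_gate_fibres[OF C(1) J C(2-4)] by auto
  let ?sep = "\<lambda>x y. {J \<in> hyperplanes V E. separated_by V E J x y}"
  have "z \<in> S" if xy: "x \<in> S" "y \<in> S" and z: "z \<in> interval V E x y" for x y z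
  proof (rule ccontr)
    assume "z \<notin> S"
    have V: "x \<in> V" "y \<in> V" "z \<in> V" and sum: "d x y = d x z + d z y"
      using xy z c by (auto simp: interval_def)
    \<comment> \<open>If \<open>x\<close> and \<open>y\<close> have different gates, the gate of
      \<open>z\<close> differs from at least one of them.\<close>
    have "?sep x y \<subseteq> ?sep x z \<union> ?sep z y"
    proof
      fix K assume "K \<in> ?sep x y"
      then have K: "K \<in> hyperplanes V E" "separated_by V E K x y" by auto
      obtain D u v where D: "maximal_clique V E D" "u \<in> D" "v \<in> D" "{u, v} \<in> K"
        using hyperplane_cliqueE[OF K(1)] .
      show "K \<in> ?sep x z \<union> ?sep z y"
        using K V by (auto simp: separated_iff_gates[OF D(1) K(1) D(2-4)])
    qed
    then have "card (?sep x y) \<le> card (?sep x z \<union> ?sep z y)"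
      using dist_eq_card_separating(1) V by (intro card_mono) auto
    moreover have "card (?sep x z) + card (?sep z y) =
        card (?sep x z \<union> ?sep z y) + card (?sep x z \<inter> ?sep z y)"
      using dist_eq_card_separating(1) V by (intro card_Un_Int) auto
    \<comment> \<open>\<open>J\<close> is counted on both sides of \<open>z\<close>, so
      \<open>d x z + d z y\<close> exceeds \<open>d x y\<close>.\<close>
    moreover have "J \<in> ?sep x z \<inter> ?sep z y"
      using J V xy \<open>z \<notin> S\<close> c sep_iff by auto
    then have "card (?sep x z \<inter> ?sep z y) > 0"
      using dist_eq_card_separating(1) V by (intro card_gt_0_iff[THEN iffD2]) blast
    ultimately show False
      using sum dist_eq_card_separating(2) V by simp
  qed
  then show ?thesis
    using c unfolding convex_subgraph_def by blast
qed

lemma geodesic_iff_crossings: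
  assumes p: "graph_path V E p"
  shows "geodesic V E p \<longleftrightarrow> (\<forall>J\<in>hyperplanes V E. crossings p J \<le> 1)"
proof
  assume once: "\<forall>J\<in>hyperplanes V E. crossings p J \<le> 1"
  have "hd p \<in> V" "last p \<in> V" using p by (auto simp: graph_path_def)
  then show "geodesic V E p"
    using card_separating_of_path(2)[OF p once] dist_eq_card_separating(2) p
    by (simp add: geodesic_def)
qed (use geodesic_crossings in blast)

section \<open>Separation by a hyperplane and the cliques it contains\<close>

lemma hyperplane_separates:
  assumes J: "J \<in> hyperplanes V E"
  shows "\<exists>x\<in>V. \<exists>y\<in>V. separated_by V E J x y"
proof -
  obtain C a b where C: "maximal_clique V E C" "a \<in> C" "b \<in> C" "{a, b} \<in> J"
    using hyperplane_cliqueE[OF J] .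
  have "{a, b} \<in> E" using hyperplane_subset[OF J] C(4) by blast
  then have "separated_by V E J a b" "a \<in> V" "b \<in> V"
    using separated_iff_gates[OF C(1) J C(2-4)] gate_of_member C edgeD by auto
  then show ?thesis by blast
qed

text \<open>In a connected graph with an edge every vertex has a neighbour, so no maximal clique is
  a single vertex. Hence \<open>induced_edges E C \<subseteq> J\<close> in
  \<open>hyperplane_clique\<close> never holds vacuously.\<close>

lemma maximal_clique_edgeE:
  assumes C: "maximal_clique V E C" and "E \<noteq> {}"
  obtains a b where "a \<in> C" "b \<in> C" "{a, b} \<in> E"
proof -
  obtain a where a: "a \<in> C" using maximal_cliqueD(3)[OF C] by blast
  obtain v where v: "{a, v} \<in> E"
  proof -
    have aV: "a \<in> V" using maximal_cliqueD(1)[OF C] a by blast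
    obtain u w where "{u, w} \<in> E" "u \<in> V" "w \<in> V" "u \<noteq> w" using \<open>E \<noteq> {}\<close> edgeE by blast
    then obtain z where "z \<in> V" "z \<noteq> a" by metis
    then have "d a z \<noteq> 0" using dist_eq_0 aV by blast
    then obtain n where "d a z = Suc n" using not0_implies_Suc by blast
    from dist_Suc[OF aV \<open>z \<in> V\<close> this] show ?thesis using that by blast
  qed
  have "C \<noteq> {a}"
  proof
    assume "C = {a}"
    moreover have "complete_subgraph V E {a, v}"
      using v edgeD[OF v] by (auto simp: complete_subgraph_def insert_commute)
    moreover have "\<forall>D. complete_subgraph V E D \<and> C \<subseteq> D \<longrightarrow> D = C"
      using C by (simp add: maximal_clique_def)
    ultimately have "{a, v} = {a}" by auto
    then show False using edgeD(3)[OF v] by auto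
  qed
  then obtain b where "b \<in> C" "b \<noteq> a" using a by blast
  then show ?thesis using that a maximal_cliqueD(2)[OF C] by metis
qed

lemma hyperplane_clique:
  assumes J: "J \<in> hyperplanes V E" and C: "maximal_clique V E C" and sub: "induced_edges E C \<subseteq> J"
  shows "x \<in> C \<Longrightarrow> y \<in> C \<Longrightarrow> x \<noteq> y \<Longrightarrow> separated_by V E J x y"
    and "S \<in> sectors V E J \<Longrightarrow> S \<inter> C \<noteq> {}"
proof -
  have "E \<noteq> {}" using hyperplane_nonempty[OF J] hyperplane_subset[OF J] by blast
  then obtain a b where ab: "a \<in> C" "b \<in> C" "{a, b} \<in> E" by (rule maximal_clique_edgeE[OF C])
  then have abJ: "{a, b} \<in> J" using sub by (auto simp: induced_edges_def)
  show "separated_by V E J x y" if "x \<in> C" "y \<in> C" "x \<noteq> y"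
    using separated_iff_gates[OF C J ab(1,2) abJ] gate_of_member[OF C] that
      maximal_cliqueD(1)[OF C] by auto
  show "S \<inter> C \<noteq> {}" if "S \<in> sectors V E J"
    using that gate_of_member[OF C] maximal_cliqueD(1)[OF C]
    unfolding sectors_eq_gate_fibres[OF C J ab(1,2) abJ] by auto
qed

end

theorem theorem3p9:
  fixes V :: "'a set" and E :: "'a set set"
  assumes "mediangle_graph V E"
  shows
    "(\<forall>J\<in>hyperplanes V E.
        (\<exists>x\<in>V. \<exists>y\<in>V. separated_by V E J x y) \<and>
        (\<forall>C. maximal_clique V E C \<and> induced_edges E C \<subseteq> J \<longrightarrow>
           (\<forall>x\<in>C. \<forall>y\<in>C. x \<noteq> y \<longrightarrow> separated_by V E J x y) \<and>
           (\<forall>S\<in>sectors V E J. S \<inter> C \<noteq> {}))) \<and>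
     (\<forall>J\<in>hyperplanes V E. \<forall>S\<in>sectors V E J. convex_subgraph V E S) \<and>
     (\<forall>p. graph_path V E p \<longrightarrow>
        (geodesic V E p \<longleftrightarrow> (\<forall>J\<in>hyperplanes V E. crossings p J \<le> 1))) \<and>
     (\<forall>x\<in>V. \<forall>y\<in>V.
        finite {J \<in> hyperplanes V E. separated_by V E J x y} \<and>
        gdist V E x y = card {J \<in> hyperplanes V E. separated_by V E J x y})"
proof -
  interpret mediangle V E by unfold_locales (rule assms)
  show ?thesis
    by (intro conjI ballI allI impI; (elim conjE)?;
        rule hyperplane_separates hyperplane_clique sector_convex geodesic_iff_crossings
          dist_eq_card_separating; assumption)
qed

end
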